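(* Let $N \ge 2$ be an integer, let $1 < p < \infty$ if $N = 2$ and $1 < p < 2^*$ if $N \ge 3$, let $1 \le q < \infty$ with $pq > 2$, and let $1 < b < b_*$. Then the ball-mass Sobolev space $E^{p,q}_b(\mathbb{R}^N)$, equipped with the norm $$\|u\|_{E^{p,q}_b(\mathbb{R}^N)} = \left(\|\nabla u\|_{L^2(\mathbb{R}^N)}^{2pq} + \|u\|_{L^{p,q}_b(\mathbb{R}^N)}^{2pq}\right)^{1/2pq},$$ is a uniformly convex Banach space.
   Context: $2^* = 2N/(N-2)$ for $N \ge 3$. $b_* = 1 + 2q$ if $N = 2$ and $b_* = 1 + Nq\,(1 - p/2^* )$ if $N \ge 3$. $B_\rho = \{x \in \mathbb{R}^N : |x| < \rho\}$. For a measurable function $u : \mathbb{R}^N \to \mathbb{R}$, $h_u(\rho) = \int_{B_\rho} |u|^p\, dy$ for $\rho > 0$, and $\|u\|_{L^{p,q}_b(\mathbb{R}^N)} = \left(\int_0^\infty \rho^{-b}\, h_u^q(\rho)\, d\rho\right)^{1/pq}$. $E^{p,q}_b(\mathbb{R}^N)$ is the space of all weakly differentiable functions $u : \mathbb{R}^N \to \mathbb{R}$ such that $\|\nabla u\|_{L^2(\mathbb{R}^N)} + \|u\|_{L^{p,q}_b(\mathbb{R}^N)} < \infty$. *)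

theory Defs
  imports "HOL-Analysis.Analysis"
begin

section \<open>Real normed spaces on a carrier set\<close>

text \<open>The spaces below depend on real parameters, so they cannot be instances of the type class
  \<^class>\<open>banach\<close>; the corresponding axioms are stated relative to a carrier.\<close>

locale normed_space_on =
  fixes V :: "'v set"
    and zero :: 'v
    and add :: "'v \<Rightarrow> 'v \<Rightarrow> 'v"
    and scale :: "real \<Rightarrow> 'v \<Rightarrow> 'v"
    and nrm :: "'v \<Rightarrow> real"
  assumes zero_closed: "zero \<in> V"
    and add_closed: "\<lbrakk>x \<in> V; y \<in> V\<rbrakk> \<Longrightarrow> add x y \<in> V"
    and scale_closed: "x \<in> V \<Longrightarrow> scale c x \<in> V"
    and add_assoc: "\<lbrakk>x \<in> V; y \<in> V; z \<in> V\<rbrakk> \<Longrightarrow> add (add x y) z = add x (add y z)"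
    and add_commute: "\<lbrakk>x \<in> V; y \<in> V\<rbrakk> \<Longrightarrow> add x y = add y x"
    and add_zero: "x \<in> V \<Longrightarrow> add x zero = x"
    and add_inverse: "x \<in> V \<Longrightarrow> add x (scale (- 1) x) = zero"
    and scale_add_right: "\<lbrakk>x \<in> V; y \<in> V\<rbrakk> \<Longrightarrow> scale c (add x y) = add (scale c x) (scale c y)"
    and scale_add_left: "x \<in> V \<Longrightarrow> scale (c + d) x = add (scale c x) (scale d x)"
    and scale_scale: "x \<in> V \<Longrightarrow> scale c (scale d x) = scale (c * d) x"
    and scale_one: "x \<in> V \<Longrightarrow> scale 1 x = x"
    and nrm_nonneg: "x \<in> V \<Longrightarrow> nrm x \<ge> 0"
    and nrm_eq_zero: "x \<in> V \<Longrightarrow> nrm x = 0 \<longleftrightarrow> x = zero"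
    and nrm_scale: "x \<in> V \<Longrightarrow> nrm (scale c x) = \<bar>c\<bar> * nrm x"
    and nrm_triangle: "\<lbrakk>x \<in> V; y \<in> V\<rbrakk> \<Longrightarrow> nrm (add x y) \<le> nrm x + nrm y"

locale banach_space_on = normed_space_on +
  assumes complete:
    "\<lbrakk>\<And>n. X n \<in> V;
      \<forall>e>0. \<exists>M. \<forall>m\<ge>M. \<forall>n\<ge>M. nrm (add (X m) (scale (- 1) (X n))) < e\<rbrakk>
     \<Longrightarrow> \<exists>x\<in>V. (\<lambda>n. nrm (add (X n) (scale (- 1) x))) \<longlonglongrightarrow> 0"

locale uniformly_convex_banach_space_on = banach_space_on +
  assumes uniformly_convex:
    "\<lbrakk>0 < e; e \<le> 2\<rbrakk> \<Longrightarrow>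
     \<exists>d>0. \<forall>x\<in>V. \<forall>y\<in>V.
       nrm x = 1 \<and> nrm y = 1 \<and> nrm (add x (scale (- 1) y)) \<ge> e
         \<longrightarrow> nrm (scale (1 / 2) (add x y)) \<le> 1 - d"

section \<open>Weak gradients\<close>

primrec Ck_fun :: "nat \<Rightarrow> ('a::euclidean_space \<Rightarrow> real) \<Rightarrow> bool" where
  "Ck_fun 0 f \<longleftrightarrow> continuous_on UNIV f"
| "Ck_fun (Suc k) f \<longleftrightarrow>
     (\<exists>G. (\<forall>x. GDERIV f x :> G x) \<and> (\<forall>i\<in>Basis. Ck_fun k (\<lambda>x. G x \<bullet> i)))"

definition test_function :: "('a::euclidean_space \<Rightarrow> real) \<Rightarrow> bool" where
  "test_function \<phi> \<longleftrightarrow> (\<forall>k. Ck_fun k \<phi>) \<and> compact (closure {x. \<phi> x \<noteq> 0})"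

definition locally_integrable ::
    "('a::euclidean_space \<Rightarrow> 'b::euclidean_space) \<Rightarrow> bool" where
  "locally_integrable f \<longleftrightarrow> (\<forall>K. compact K \<longrightarrow> f absolutely_integrable_on K)"

text \<open>The vector-valued identity collects the identities
  \<open>\<integral> u \<partial>\<^sub>i\<phi> = - \<integral> \<phi> G\<^sub>i\<close> for all coordinates \<open>i\<close>.\<close>

definition has_weak_gradient ::
    "('a::euclidean_space \<Rightarrow> real) \<Rightarrow> ('a \<Rightarrow> 'a) \<Rightarrow> bool" where
  "has_weak_gradient u G \<longleftrightarrow>
     locally_integrable u \<and> locally_integrable G \<and>
     (\<forall>\<phi> D\<phi>. test_function \<phi> \<and> (\<forall>x. GDERIV \<phi> x :> D\<phi> x) \<longrightarrow>
        (LINT x|lebesgue. u x *\<^sub>R D\<phi> x) = - (LINT x|lebesgue. \<phi> x *\<^sub>R G x))"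

definition weakly_differentiable :: "('a::euclidean_space \<Rightarrow> real) \<Rightarrow> bool" where
  "weakly_differentiable u \<longleftrightarrow> (\<exists>G. has_weak_gradient u G)"

text \<open>A weak gradient is unique up to null sets, so the choice does not affect its norm.\<close>

definition weak_gradient :: "('a::euclidean_space \<Rightarrow> real) \<Rightarrow> 'a \<Rightarrow> 'a" where
  "weak_gradient u = (SOME G. has_weak_gradient u G)"

section \<open>Ball-mass Sobolev spaces\<close>

text \<open>Used for exponents \<open>a > 0\<close> only.\<close>

definition ennpowr :: "ennreal \<Rightarrow> real \<Rightarrow> ennreal" where
  "ennpowr x a = (if x = \<infinity> then \<infinity> else ennreal (enn2real x powr a))"

definition ball_mass :: "real \<Rightarrow> ('a::euclidean_space \<Rightarrow> real) \<Rightarrow> real \<Rightarrow> ennreal" where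
  "ball_mass p u \<rho> = (\<integral>\<^sup>+ y \<in> ball 0 \<rho>. ennreal (\<bar>u y\<bar> powr p) \<partial>lebesgue)"

definition L_norm ::
    "real \<Rightarrow> real \<Rightarrow> real \<Rightarrow> ('a::euclidean_space \<Rightarrow> real) \<Rightarrow> ennreal" where
  "L_norm p q b u =
     ennpowr (\<integral>\<^sup>+ \<rho> \<in> {0<..}. ennreal (\<rho> powr (- b)) * ennpowr (ball_mass p u \<rho>) q \<partial>lebesgue)
       (1 / (p * q))"

definition grad_norm :: "('a::euclidean_space \<Rightarrow> real) \<Rightarrow> ennreal" where
  "grad_norm u = ennpowr (\<integral>\<^sup>+ x. ennreal ((norm (weak_gradient u x))\<^sup>2) \<partial>lebesgue) (1 / 2)"

definition E_fun :: "real \<Rightarrow> real \<Rightarrow> real \<Rightarrow> ('a::euclidean_space \<Rightarrow> real) set" where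
  "E_fun p q b = {u. weakly_differentiable u \<and> grad_norm u + L_norm p q b u < \<infinity>}"

definition E_fun_norm ::
    "real \<Rightarrow> real \<Rightarrow> real \<Rightarrow> ('a::euclidean_space \<Rightarrow> real) \<Rightarrow> real" where
  "E_fun_norm p q b u =
     (enn2real (grad_norm u) powr (2 * p * q) + enn2real (L_norm p q b u) powr (2 * p * q))
       powr (1 / (2 * p * q))"

text \<open>As usual, functions that agree almost everywhere are identified: the space consists of
  equivalence classes, with operations and norm induced from representatives.\<close>

definition ae_eq :: "(('a::euclidean_space \<Rightarrow> real) \<times> ('a \<Rightarrow> real)) set" where
  "ae_eq = {(u, v). AE x in lebesgue. u x = v x}"

definition ae_zero :: "('a::euclidean_space \<Rightarrow> real) set" where
  "ae_zero = ae_eq `` {\<lambda>x. 0}"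

definition ae_add ::
    "('a::euclidean_space \<Rightarrow> real) set \<Rightarrow> ('a \<Rightarrow> real) set \<Rightarrow> ('a \<Rightarrow> real) set" where
  "ae_add U V = (\<Union>u\<in>U. \<Union>v\<in>V. ae_eq `` {\<lambda>x. u x + v x})"

definition ae_scale :: "real \<Rightarrow> ('a::euclidean_space \<Rightarrow> real) set \<Rightarrow> ('a \<Rightarrow> real) set" where
  "ae_scale c U = (\<Union>u\<in>U. ae_eq `` {\<lambda>x. c * u x})"

definition E_space :: "real \<Rightarrow> real \<Rightarrow> real \<Rightarrow> ('a::euclidean_space \<Rightarrow> real) set set" where
  "E_space p q b = E_fun p q b // ae_eq"

definition E_norm :: "real \<Rightarrow> real \<Rightarrow> real \<Rightarrow> ('a::euclidean_space \<Rightarrow> real) set \<Rightarrow> real" where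
  "E_norm p q b U = the_elem (E_fun_norm p q b ` U)"

definition sobolev_exponent :: "nat \<Rightarrow> real" where
  "sobolev_exponent N = 2 * real N / (real N - 2)"

text \<open>Relevant for \<open>N \<ge> 2\<close> only.\<close>

definition b_star :: "nat \<Rightarrow> real \<Rightarrow> real \<Rightarrow> real" where
  "b_star N p q =
     (if N = 2 then 1 + 2 * q else 1 + real N * q * (1 - p / sobolev_exponent N))"

end

theory Submission
  imports Defs "HOL-Real_Asymp.Real_Asymp"
begin

text \<open>
  The norm of the space is an iterated norm. At a point one takes \<open>\<bar>u y\<bar>\<close>, on each ball the
  \<open>L\<^sup>p\<close> norm, then the \<open>L\<^bsup>pq\<^esup>\<close> norm of the result over the radii with respect to
  \<open>\<rho>\<^bsup>-b\<^esup> d\<rho>\<close>, and finally the \<open>\<ell>\<^bsup>2pq\<^esup>\<close> norm of the pair formed with the \<open>L\<^sup>2\<close> norm of the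
  weak gradient. Every step forms an \<open>L\<^sup>s\<close> norm of a family of seminorms with some \<open>s > 1\<close>, so
  one lemma on each of the triangle inequality, Fatou's lemma and uniform convexity is applied at
  all levels.

  For uniform convexity, consider the quadruple \<open>(a, b, m, d)\<close> of the (semi)norms of
  \<open>x\<close>, \<open>y\<close>, \<open>(x + y) / 2\<close> and \<open>x - y\<close>. A modulus of convexity for a homogeneous
  class of quadruples yields, for every \<open>s > 1\<close> and \<open>\<eta> > 0\<close>, a constant \<open>C\<close> with
  \<open>d\<^sup>s \<le> \<eta> (a\<^sup>s + b\<^sup>s) + C ((a\<^sup>s + b\<^sup>s) / 2 - m\<^sup>s)\<close> (lemma \<open>uc_quad_powr\<close>). This inequality
  can be integrated, and the integrated inequality gives back a modulus, which depends neither on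
  the functions nor on the measure (\<open>uc_quad_Lp_norm\<close>). The independence of the measure
  makes the modulus uniform in the balls, and the induction starts from the
  parallelogram law.

  For completeness, the ball-mass norm dominates the \<open>L\<^sup>p\<close> norm on every ball
  (\<open>ball_norm_le_mass_norm\<close>). Hence a rapidly converging subsequence of a Cauchy sequence and its
  weak gradients converge almost everywhere, Fatou's lemma at each level bounds the distance to the
  limit, and weak gradients persist under local \<open>L\<^sup>1\<close> convergence (\<open>has_weak_gradient_limit\<close>).

  That the norm is well defined and compatible with the linear structure rests on the almost
  everywhere uniqueness of weak gradients, by the fundamental lemma of the calculus of variations:
  explicit smooth bumps approximate the indicator functions of boxes, and a locally integrable
  function whose integral over every box vanishes is zero almost everywhere.
\<close>

section \<open>Convexity of powers\<close>

lemma powr_convex_combination: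
  fixes a b l s :: real
  assumes "s \<ge> 1" "a \<ge> 0" "b \<ge> 0" "0 \<le> l" "l \<le> 1"
  shows "(l * a + (1 - l) * b) powr s \<le> l * a powr s + (1 - l) * b powr s"
proof -
  have scale: "(c * x) powr s \<le> c * x powr s" if "0 \<le> c" "c \<le> 1" "0 \<le> x" for c x :: real
  proof (cases "c = 0")
    case False
    then have "c powr s \<le> c powr 1"
      using that assms by (intro powr_mono') auto
    then have "c powr s \<le> c" using False that by simp
    then show ?thesis using that by (simp add: powr_mult mult_right_mono)
  qed simp
  show ?thesis
  proof (cases "a = 0 \<or> b = 0")
    case True
    then show ?thesis
      using scale[of l a] scale[of "1 - l" b] assms by auto
  next
    case False
    then show ?thesis
      using convex_onD[OF powr_convex[OF assms(1)], of "1 - l" a b] assms by simp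
  qed
qed

lemma powr_midpoint_strict:
  fixes b t :: real
  assumes "t > 1" "0 \<le> b" "b < 1"
  shows "((1 + b) / 2) powr t < (1 + b powr t) / 2"
proof -
  let ?h = "\<lambda>b::real. (1 + b powr t) / 2 - ((1 + b) / 2) powr t"
  have "?h b > ?h 1"
  proof (rule DERIV_neg_imp_decreasing_open[OF assms(3)])
    fix x :: real assume x: "b < x" "x < 1"
    then have "x > 0" using assms by simp
    have "(?h has_real_derivative t / 2 * (x powr (t - 1) - ((1 + x) / 2) powr (t - 1))) (at x)"
      using \<open>x > 0\<close> by (auto intro!: derivative_eq_intros simp: field_simps)
    moreover have "x powr (t - 1) < ((1 + x) / 2) powr (t - 1)"
      using x \<open>x > 0\<close> assms by (intro powr_less_mono2) auto
    ultimately show "\<exists>y. (?h has_real_derivative y) (at x) \<and> y < 0"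
      using assms by (intro exI conjI) (auto simp: mult_pos_neg)
  next
    show "continuous_on {b..1} ?h"
      using assms by (intro continuous_intros continuous_on_powr') auto
  qed
  then show ?thesis by simp
qed

section \<open>Norms of nonnegative functions\<close>

text \<open>Membership in \<open>L\<^sup>s\<close> and the \<open>L\<^sup>s\<close> norm, for nonnegative real functions only: they are applied
  to pointwise norms, which themselves may be \<open>L\<^sup>t\<close> norms of another level.\<close>

definition Lp_fun :: "'w measure \<Rightarrow> real \<Rightarrow> ('w \<Rightarrow> real) \<Rightarrow> bool" where
  "Lp_fun M s f \<longleftrightarrow> f \<in> borel_measurable M \<and> (\<forall>x\<in>space M. 0 \<le> f x) \<and>
     integrable M (\<lambda>x. f x powr s)"

definition Lp_norm :: "'w measure \<Rightarrow> real \<Rightarrow> ('w \<Rightarrow> real) \<Rightarrow> real" where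
  "Lp_norm M s f = (LINT x|M. f x powr s) powr (1 / s)"

lemma Lp_norm_nonneg: "0 \<le> Lp_norm M s f"
  by (simp add: Lp_norm_def)

lemma Lp_norm_powr: "s > 0 \<Longrightarrow> Lp_norm M s f powr s = (LINT x|M. f x powr s)"
  by (simp add: Lp_norm_def powr_powr)

lemma Lp_norm_leI:
  assumes "s > 0" "0 \<le> c" "(LINT x|M. f x powr s) \<le> c powr s"
  shows "Lp_norm M s f \<le> c"
proof -
  have "Lp_norm M s f \<le> (c powr s) powr (1 / s)"
    unfolding Lp_norm_def using assms by (intro powr_mono2) auto
  then show ?thesis using assms by (simp add: powr_powr)
qed

lemma Lp_norm_le_powrD:
  assumes "s > 0" "Lp_norm M s f \<le> c"
  shows "(LINT x|M. f x powr s) \<le> c powr s"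
  using powr_mono2[of s "Lp_norm M s f" c] assms by (simp add: Lp_norm_powr Lp_norm_nonneg)

lemma Lp_mono:
  assumes "s > 0" "Lp_fun M s g" "f \<in> borel_measurable M"
    "\<And>x. x \<in> space M \<Longrightarrow> 0 \<le> f x" "\<And>x. x \<in> space M \<Longrightarrow> f x \<le> g x"
  shows "Lp_fun M s f" "Lp_norm M s f \<le> Lp_norm M s g"
proof -
  have g: "integrable M (\<lambda>x. g x powr s)" using assms by (simp add: Lp_fun_def)
  have le: "f x powr s \<le> g x powr s" if "x \<in> space M" for x
    using assms that by (intro powr_mono2) auto
  have f: "integrable M (\<lambda>x. f x powr s)"
    by (rule Bochner_Integration.integrable_bound[OF g])
       (use assms(3) le in auto)
  then show "Lp_fun M s f" using assms by (simp add: Lp_fun_def)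
  have "(LINT x|M. f x powr s) \<le> (LINT x|M. g x powr s)"
    by (rule integral_mono[OF f g]) (rule le)
  then show "Lp_norm M s f \<le> Lp_norm M s g"
    unfolding Lp_norm_def using assms by (intro powr_mono2) auto
qed

lemma Lp_cong_AE:
  assumes "Lp_fun M s g" "f \<in> borel_measurable M" "\<And>x. x \<in> space M \<Longrightarrow> 0 \<le> f x"
    "AE x in M. f x = g x"
  shows "Lp_fun M s f" "Lp_norm M s f = Lp_norm M s g"
proof -
  have g: "integrable M (\<lambda>x. g x powr s)" "g \<in> borel_measurable M"
    using assms by (auto simp: Lp_fun_def)
  have "integrable M (\<lambda>x. f x powr s) = integrable M (\<lambda>x. g x powr s)"
    using assms g by (intro integrable_cong_AE) auto
  then show "Lp_fun M s f" using assms g by (simp add: Lp_fun_def)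
  have "(LINT x|M. f x powr s) = (LINT x|M. g x powr s)"
    using assms g by (intro integral_cong_AE) auto
  then show "Lp_norm M s f = Lp_norm M s g" by (simp add: Lp_norm_def)
qed

lemma Lp_scale:
  assumes "s > 0" "c \<ge> 0" "Lp_fun M s f"
  shows "Lp_fun M s (\<lambda>x. c * f x)" "Lp_norm M s (\<lambda>x. c * f x) = c * Lp_norm M s f"
proof -
  have eq: "x \<in> space M \<Longrightarrow> (c * f x) powr s = c powr s * f x powr s" for x
    using assms by (auto simp: Lp_fun_def powr_mult)
  have "integrable M (\<lambda>x. (c * f x) powr s) \<longleftrightarrow> integrable M (\<lambda>x. c powr s * f x powr s)"
    by (rule Bochner_Integration.integrable_cong) (auto simp: eq)
  then show "Lp_fun M s (\<lambda>x. c * f x)" using assms by (auto simp: Lp_fun_def)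
  have "(LINT x|M. (c * f x) powr s) = (LINT x|M. c powr s * f x powr s)"
    by (rule Bochner_Integration.integral_cong) (auto simp: eq)
  also have "\<dots> = c powr s * (LINT x|M. f x powr s)" by simp
  finally show "Lp_norm M s (\<lambda>x. c * f x) = c * Lp_norm M s f"
    using assms by (simp add: Lp_norm_def powr_mult powr_powr)
qed

text \<open>Minkowski's inequality, from the convexity of \<open>t\<^sup>s\<close> applied to the normalised functions with
  weights proportional to the norms.\<close>

lemma Lp_add:
  assumes "s \<ge> 1" "Lp_fun M s f" "Lp_fun M s g"
  shows "Lp_fun M s (\<lambda>x. f x + g x)"
    "Lp_norm M s (\<lambda>x. f x + g x) \<le> Lp_norm M s f + Lp_norm M s g"
proof -
  have nonneg: "0 \<le> f x" "0 \<le> g x" if "x \<in> space M" for x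
    using assms that by (auto simp: Lp_fun_def)
  have int: "integrable M (\<lambda>x. f x powr s)" "integrable M (\<lambda>x. g x powr s)"
    and meas: "f \<in> borel_measurable M" "g \<in> borel_measurable M"
    using assms by (auto simp: Lp_fun_def)
  have bound: "(f x + g x) powr s
      \<le> (a + b) powr s * (a / (a + b) * (f x powr s / a powr s) + b / (a + b) * (g x powr s / b powr s))"
    if "a > 0" "b > 0" "x \<in> space M" for a b x
  proof -
    have eq: "1 - a / (a + b) = b / (a + b)" using that by (simp add: field_simps)
    have "f x + g x = (a + b) * (a / (a + b) * (f x / a) + (1 - a / (a + b)) * (g x / b))"
    proof -
      have "(a + b) * (a / (a + b) * (f x / a) + b / (a + b) * (g x / b))
          = ((a + b) / (a + b)) * (a / a * f x + b / b * g x)"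
        by (simp only: distrib_left times_divide_eq_left times_divide_eq_right mult_ac)
      then show ?thesis using that by (simp add: eq)
    qed
    also have "\<dots> powr s = (a + b) powr s * (a / (a + b) * (f x / a) + (1 - a / (a + b)) * (g x / b)) powr s"
      using that nonneg by (intro powr_mult) 
    also have "\<dots> \<le> (a + b) powr s * (a / (a + b) * (f x / a) powr s + (1 - a / (a + b)) * (g x / b) powr s)"
      using that nonneg assms by (intro mult_left_mono powr_convex_combination) auto
    also note eq
    finally show ?thesis using that nonneg by (simp add: powr_divide)
  qed
  have int2: "integrable M (\<lambda>x. (f x + g x) powr s)"
  proof (rule Bochner_Integration.integrable_bound)
    show "integrable M (\<lambda>x. 2 powr s * (1 / 2 * f x powr s + 1 / 2 * g x powr s))"
      using int by auto
    show "AE x in M. norm ((f x + g x) powr s)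
        \<le> norm (2 powr s * (1 / 2 * f x powr s + 1 / 2 * g x powr s))"
      using bound[of 1 1] by (intro AE_I2) auto
  qed (use meas in auto)
  then show "Lp_fun M s (\<lambda>x. f x + g x)"
    using meas nonneg by (auto simp: Lp_fun_def)
  let ?A = "Lp_norm M s f" and ?B = "Lp_norm M s g"
  have "Lp_norm M s (\<lambda>x. f x + g x) \<le> ?A + ?B + e" if "e > 0" for e
  proof (rule Lp_norm_leI)
    \<comment> \<open>shifting by \<open>e / 2\<close> keeps the normalising factors positive when a norm vanishes\<close>
    define a b where "a = ?A + e / 2" and "b = ?B + e / 2"
    have pos: "a > 0" "b > 0"
      using that Lp_norm_nonneg[of M s] by (auto simp: a_def b_def add_nonneg_pos)
    have IA: "(LINT x|M. f x powr s) / a powr s \<le> 1" "(LINT x|M. g x powr s) / b powr s \<le> 1"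
      using Lp_norm_le_powrD[of s M f a] Lp_norm_le_powrD[of s M g b] pos assms that
      by (auto simp: a_def b_def)
    have "(LINT x|M. (f x + g x) powr s) \<le> (LINT x|M. (a + b) powr s *
       (a / (a + b) * (f x powr s / a powr s) + b / (a + b) * (g x powr s / b powr s)))"
      using bound pos int int2 by (intro integral_mono) auto
    also have "\<dots> = (a + b) powr s * (a / (a + b) * ((LINT x|M. f x powr s) / a powr s)
        + b / (a + b) * ((LINT x|M. g x powr s) / b powr s))"
      using int by simp
    also have "\<dots> \<le> (a + b) powr s * (a / (a + b) * 1 + b / (a + b) * 1)"
      using IA pos by (intro mult_left_mono add_mono) auto
    also have "\<dots> = (a + b) powr s" using pos by (simp flip: add_divide_distrib)
    also have "a + b = ?A + ?B + e" by (simp add: a_def b_def)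
    finally show "(LINT x|M. (f x + g x) powr s) \<le> (?A + ?B + e) powr s" .
  qed (use assms that Lp_norm_nonneg[of M s] in auto)
  then show "Lp_norm M s (\<lambda>x. f x + g x) \<le> ?A + ?B"
    by (rule field_le_epsilon)
qed

lemma Lp_triangle:
  assumes "s \<ge> 1" "Lp_fun M s f" "Lp_fun M s g" "h \<in> borel_measurable M"
    "\<And>x. x \<in> space M \<Longrightarrow> 0 \<le> h x" "\<And>x. x \<in> space M \<Longrightarrow> h x \<le> f x + g x"
  shows "Lp_fun M s h" "Lp_norm M s h \<le> Lp_norm M s f + Lp_norm M s g"
  using Lp_mono[OF _ Lp_add(1)[OF assms(1-3)] assms(4-6)] Lp_add(2)[OF assms(1-3)] assms(1)
  by auto

lemma Lp_norm_eq_0_iff: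
  assumes "s > 0" "Lp_fun M s f"
  shows "Lp_norm M s f = 0 \<longleftrightarrow> (AE x in M. f x = 0)"
proof -
  have "Lp_norm M s f = 0 \<longleftrightarrow> (LINT x|M. f x powr s) = 0"
    by (simp add: Lp_norm_def)
  also have "\<dots> \<longleftrightarrow> (AE x in M. f x powr s = 0)"
    using assms by (intro integral_nonneg_eq_0_iff_AE) (auto simp: Lp_fun_def)
  finally show ?thesis by simp
qed

text \<open>On a finite measure space the \<open>L\<^sup>s\<close> norm controls the integral. The bound follows from
  \<open>t \<le> c + c\<^bsup>1 - s\<^esup> t\<^sup>s\<close> with \<open>c\<close> the norm itself.\<close>

lemma integral_le_Lp_norm:
  assumes "s \<ge> 1" "finite_measure M" "Lp_fun M s f"
  shows "integrable M f" "(LINT x|M. f x) \<le> (measure M (space M) + 1) * Lp_norm M s f"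
proof -
  interpret finite_measure M by fact
  have nonneg: "\<And>x. x \<in> space M \<Longrightarrow> 0 \<le> f x"
    and int: "integrable M (\<lambda>x. f x powr s)" and meas: "f \<in> borel_measurable M"
    using assms by (auto simp: Lp_fun_def)
  have bound: "t \<le> c + c powr (1 - s) * t powr s" if "t \<ge> 0" "c > 0" for t c :: real
  proof (cases "t \<le> c")
    case False
    then have "t = t powr (1 - s) * t powr s"
      using that by (simp flip: powr_add)
    also have "\<dots> \<le> c powr (1 - s) * t powr s"
      using False that assms by (intro mult_right_mono powr_mono2') auto
    finally show ?thesis using that by simp
  qed (use that in \<open>simp add: add_increasing2\<close>)
  show intf: "integrable M f"
  proof (rule Bochner_Integration.integrable_bound)
    show "integrable M (\<lambda>x. 1 + 1 powr (1 - s) * f x powr s)" using int by simp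
    show "AE x in M. norm (f x) \<le> norm (1 + 1 powr (1 - s) * f x powr s)"
      using bound[of _ 1] nonneg by (intro AE_I2) auto
  qed fact
  let ?N = "Lp_norm M s f"
  show "(LINT x|M. f x) \<le> (measure M (space M) + 1) * ?N"
  proof (cases "?N = 0")
    case True
    then have "AE x in M. f x = 0" using Lp_norm_eq_0_iff[OF _ assms(3)] assms(1) by auto
    then have "(LINT x|M. f x) = 0" by (rule integral_eq_zero_AE)
    then show ?thesis using True by simp
  next
    case False
    then have pos: "?N > 0" using Lp_norm_nonneg[of M s f] by simp
    have "(LINT x|M. f x) \<le> (LINT x|M. ?N + ?N powr (1 - s) * f x powr s)"
      using bound nonneg pos int by (intro integral_mono intf) auto
    also have "\<dots> = measure M (space M) * ?N + ?N powr (1 - s) * ?N powr s"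
      using int assms by (simp add: Lp_norm_powr)
    also have "?N powr (1 - s) * ?N powr s = ?N"
      using pos by (simp flip: powr_add)
    finally show ?thesis by (simp add: algebra_simps)
  qed
qed

lemma Lp_Fatou:
  assumes "s > 0" "\<And>k::nat. Lp_fun M s (f k)" "\<And>k. Lp_norm M s (f k) \<le> c"
    and "AE x in M. (\<lambda>k. f k x) \<longlonglongrightarrow> g x"
    and "g \<in> borel_measurable M" "\<And>x. x \<in> space M \<Longrightarrow> 0 \<le> g x"
  shows "Lp_fun M s g" "Lp_norm M s g \<le> c"
proof -
  have c: "0 \<le> c" using assms(3)[of 0] Lp_norm_nonneg order_trans by blast
  have meas[measurable]: "f k \<in> borel_measurable M" "g \<in> borel_measurable M" for k
    using assms by (auto simp: Lp_fun_def)
  have fk: "(\<integral>\<^sup>+x. ennreal (f k x powr s) \<partial>M) \<le> ennreal (c powr s)" for k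
    using Lp_norm_le_powrD[OF assms(1,3), of k] assms(2)[of k]
    by (subst nn_integral_eq_integral) (auto simp: Lp_fun_def ennreal_leI)
  have "AE x in M. ennreal (g x powr s) = liminf (\<lambda>k. ennreal (f k x powr s))"
    using assms(4) AE_space
  proof eventually_elim
    case (elim x)
    have "(\<lambda>k. ennreal (f k x powr s)) \<longlonglongrightarrow> ennreal (g x powr s)"
      using elim assms(1,2)
      by (intro tendsto_ennrealI tendsto_powr' tendsto_const)
         (auto simp: Lp_fun_def eventually_sequentially)
    then show ?case using lim_imp_Liminf[OF sequentially_bot] by metis
  qed
  then have "(\<integral>\<^sup>+x. ennreal (g x powr s) \<partial>M) = (\<integral>\<^sup>+x. liminf (\<lambda>k. ennreal (f k x powr s)) \<partial>M)"
    by (rule nn_integral_cong_AE)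
  also have "\<dots> \<le> liminf (\<lambda>k. \<integral>\<^sup>+x. ennreal (f k x powr s) \<partial>M)"
    by (rule nn_integral_liminf) simp
  also have "\<dots> \<le> ennreal (c powr s)"
    using fk by (intro Liminf_le) auto
  finally have le: "(\<integral>\<^sup>+x. ennreal (g x powr s) \<partial>M) \<le> ennreal (c powr s)" .
  have int: "integrable M (\<lambda>x. g x powr s)"
    using le by (intro integrableI_nonneg) (auto intro: order.strict_trans1)
  then show "Lp_fun M s g" using assms by (auto simp: Lp_fun_def)
  have "(LINT x|M. g x powr s) \<le> c powr s"
    using le int by (subst (asm) nn_integral_eq_integral) auto
  then show "Lp_norm M s g \<le> c"
    by (intro Lp_norm_leI assms c)
qed

text \<open>The measure of the space being finite, summability of the \<open>L\<^sup>s\<close> norms is summability of the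
  integrals, so monotone convergence applies.\<close>

lemma AE_summable_of_Lp_norm:
  assumes "s \<ge> 1" "finite_measure M" "\<And>k::nat. Lp_fun M s (f k)"
    "summable (\<lambda>k. Lp_norm M s (f k))"
  shows "AE x in M. summable (\<lambda>k. f k x)"
proof -
  have [measurable]: "f k \<in> borel_measurable M" for k using assms by (auto simp: Lp_fun_def)
  have nonneg: "x \<in> space M \<Longrightarrow> 0 \<le> f k x" for k x using assms by (auto simp: Lp_fun_def)
  let ?c = "measure M (space M) + 1"
  have "(\<integral>\<^sup>+x. (\<Sum>k. ennreal (f k x)) \<partial>M) = (\<Sum>k. \<integral>\<^sup>+x. ennreal (f k x) \<partial>M)"
    by (rule nn_integral_suminf) simp
  also have "\<dots> \<le> (\<Sum>k. ennreal (?c * Lp_norm M s (f k)))"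
  proof (rule suminf_le)
    fix k
    show "(\<integral>\<^sup>+x. ennreal (f k x) \<partial>M) \<le> ennreal (?c * Lp_norm M s (f k))"
      using integral_le_Lp_norm[OF assms(1,2) assms(3)[of k]] nonneg
      by (subst nn_integral_eq_integral) (auto intro: ennreal_leI)
  qed auto
  also have "\<dots> = ennreal (\<Sum>k. ?c * Lp_norm M s (f k))"
    using assms(4) by (intro suminf_ennreal2) (auto simp: Lp_norm_nonneg)
  also have "\<dots> < \<infinity>" by simp
  finally have "AE x in M. (\<Sum>k. ennreal (f k x)) \<noteq> \<infinity>"
    by (intro nn_integral_PInf_AE) auto
  then show ?thesis
    using AE_space
  proof eventually_elim
    case (elim x)
    then show ?case using nonneg by (intro summable_suminf_not_top) auto
  qed
qed

section \<open>Uniform convexity through quadruples of norms\<close>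

text \<open>The numbers \<open>a, b, m, d\<close> stand for the norms of \<open>x\<close>, \<open>y\<close>, \<open>(x + y) / 2\<close> and \<open>x - y\<close>, and
  \<open>\<delta>\<close> is a modulus of convexity: if \<open>x\<close> and \<open>y\<close> lie in the ball of radius \<open>k\<close> and have distance
  at least \<open>\<epsilon> k\<close>, then the midpoint lies in the ball of radius \<open>(1 - \<delta> \<epsilon>) k\<close>. The radius is
  arbitrary, so that the condition is invariant under scaling and free of any exponent.\<close>

definition uc_quad :: "(real \<Rightarrow> real) \<Rightarrow> real \<Rightarrow> real \<Rightarrow> real \<Rightarrow> real \<Rightarrow> bool" where
  "uc_quad \<delta> a b m d \<longleftrightarrow> 0 \<le> a \<and> 0 \<le> b \<and> 0 \<le> m \<and> 0 \<le> d \<and> m \<le> (a + b) / 2 \<and> d \<le> a + b \<and>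
     (\<forall>\<epsilon>>0. \<forall>k. a \<le> k \<and> b \<le> k \<and> \<epsilon> * k \<le> d \<longrightarrow> m \<le> (1 - \<delta> \<epsilon>) * k)"

lemma uc_quad_mono:
  assumes "uc_quad \<delta> a b m d" "\<And>\<epsilon>. \<epsilon> > 0 \<Longrightarrow> \<delta>' \<epsilon> \<le> \<delta> \<epsilon>"
  shows "uc_quad \<delta>' a b m d"
  unfolding uc_quad_def
proof (intro conjI allI impI)
  fix \<epsilon> k :: real assume *: "\<epsilon> > 0" "a \<le> k \<and> b \<le> k \<and> \<epsilon> * k \<le> d"
  then have "m \<le> (1 - \<delta> \<epsilon>) * k" "0 \<le> k" using assms(1) unfolding uc_quad_def by force+
  moreover have "(1 - \<delta> \<epsilon>) * k \<le> (1 - \<delta>' \<epsilon>) * k"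
    using assms(2)[OF *(1)] \<open>0 \<le> k\<close> by (intro mult_right_mono) auto
  ultimately show "m \<le> (1 - \<delta>' \<epsilon>) * k" by simp
qed (use assms in \<open>auto simp: uc_quad_def\<close>)

text \<open>Inner product spaces are uniformly convex, by the parallelogram law.\<close>

lemma uc_quad_inner:
  fixes x y :: "'v::real_inner"
  shows "uc_quad (\<lambda>\<epsilon>. \<epsilon>\<^sup>2 / 8) (norm x) (norm y) (norm ((1 / 2) *\<^sub>R (x + y))) (norm (x - y))"
  unfolding uc_quad_def
proof (intro conjI allI impI)
  fix \<epsilon> k :: real
  assume e: "\<epsilon> > 0" and *: "norm x \<le> k \<and> norm y \<le> k \<and> \<epsilon> * k \<le> norm (x - y)"
  let ?m = "norm ((1 / 2) *\<^sub>R (x + y))"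
  have k: "0 \<le> k" using * norm_ge_zero order_trans by blast
  show "?m \<le> (1 - \<epsilon>\<^sup>2 / 8) * k"
  proof (cases "k = 0")
    case True
    then show ?thesis using * by simp
  next
    case False
    then have kp: "k > 0" using k by simp
    have "\<epsilon> * k \<le> 2 * k" using * norm_triangle_ineq4[of x y] by linarith
    then have e2: "\<epsilon> \<le> 2" using kp by simp
    then have "\<epsilon>\<^sup>2 \<le> 2\<^sup>2" using e by (intro power_mono) auto
    then have e3: "\<epsilon>\<^sup>2 / 8 \<le> 1" by simp
    have "4 * ?m\<^sup>2 = 2 * (norm x)\<^sup>2 + 2 * (norm y)\<^sup>2 - (norm (x - y))\<^sup>2"
      by (simp add: power_divide power2_norm_eq_inner inner_add_left inner_add_right
          inner_diff_left inner_diff_right inner_commute)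
    moreover have "(norm x)\<^sup>2 \<le> k\<^sup>2" "(norm y)\<^sup>2 \<le> k\<^sup>2" "(\<epsilon> * k)\<^sup>2 \<le> (norm (x - y))\<^sup>2"
      using * e k by (auto intro!: power_mono)
    ultimately have "4 * ?m\<^sup>2 \<le> 4 * k\<^sup>2 - \<epsilon>\<^sup>2 * k\<^sup>2" by (simp add: power_mult_distrib)
    also have "\<dots> \<le> 4 * ((1 - \<epsilon>\<^sup>2 / 8) * k)\<^sup>2"
      using zero_le_power2[of "\<epsilon>\<^sup>2 * k"]
      by (simp add: power_mult_distrib power2_eq_square algebra_simps del: zero_le_power2)
    finally have "?m\<^sup>2 \<le> ((1 - \<epsilon>\<^sup>2 / 8) * k)\<^sup>2" by simp
    then show ?thesis by (rule power2_le_imp_le) (use e3 k in auto)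
  qed
next
  show "norm ((1 / 2) *\<^sub>R (x + y)) \<le> (norm x + norm y) / 2"
    using norm_triangle_ineq[of x y] by simp
qed (auto simp: norm_triangle_ineq4)

text \<open>The passage from a modulus to an inequality that is homogeneous of degree \<open>t\<close>. With \<open>b \<le> a\<close>
  and \<open>\<beta> = b / a\<close>, either \<open>d\<close> is small compared with \<open>a\<close>, or \<open>m / a\<close> is at most
  \<open>min ((1 + \<beta>) / 2) (1 - \<delta> \<epsilon>)\<close>; in the latter case \<open>(1 + \<beta>\<^sup>t) / 2 - (m / a)\<^sup>t\<close> is bounded below by the
  minimum over \<open>\<beta> \<in> [0, 1]\<close> of a continuous function, which is positive by strict convexity.\<close>

lemma uc_quad_powr:
  fixes t :: real
  assumes "t > 1" and \<delta>: "\<And>\<epsilon>. \<epsilon> > 0 \<Longrightarrow> \<delta> \<epsilon> > 0" and "\<eta> > 0"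
  obtains C where "C > 0" and "\<And>a b m d. uc_quad \<delta> a b m d \<Longrightarrow>
    d powr t \<le> \<eta> * (a powr t + b powr t) + C * ((a powr t + b powr t) / 2 - m powr t)"
proof -
  define \<epsilon> where "\<epsilon> = \<eta> powr (1 / t)"
  have \<epsilon>: "\<epsilon> > 0" "\<epsilon> powr t = \<eta>" using assms by (auto simp: \<epsilon>_def powr_powr)
  define \<kappa> where "\<kappa> = max 0 (1 - \<delta> \<epsilon>)"
  have \<kappa>: "0 \<le> \<kappa>" "\<kappa> < 1" using \<delta>[OF \<epsilon>(1)] by (auto simp: \<kappa>_def)
  define f where "f = (\<lambda>\<beta>::real. (1 + \<beta> powr t) / 2 - (min ((1 + \<beta>) / 2) \<kappa>) powr t)"
  have "continuous_on {0..1} f"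
    unfolding f_def using \<kappa> assms by (intro continuous_intros continuous_on_powr') auto
  then obtain \<beta>0 where \<beta>0: "\<beta>0 \<in> {0..1}" "\<And>\<beta>. \<beta> \<in> {0..1} \<Longrightarrow> f \<beta>0 \<le> f \<beta>"
    using continuous_attains_inf[of "{0..1::real}" f] by auto
  define c where "c = f \<beta>0"
  have c: "c > 0"
  proof (cases "\<beta>0 = 1")
    case True
    have "\<kappa> powr t < 1 powr t" using \<kappa> assms by (intro powr_less_mono2) auto
    then show ?thesis using True \<kappa> by (simp add: c_def f_def min_def)
  next
    case False
    then have "((1 + \<beta>0) / 2) powr t < (1 + \<beta>0 powr t) / 2"
      using \<beta>0 assms by (intro powr_midpoint_strict) auto
    moreover have "min ((1 + \<beta>0) / 2) \<kappa> powr t \<le> ((1 + \<beta>0) / 2) powr t"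
      using \<kappa> \<beta>0(1) assms by (intro powr_mono2 min.cobounded1) auto
    ultimately show ?thesis by (simp add: c_def f_def)
  qed
  show ?thesis
  proof
    show "2 powr t / c > 0" using c by simp
    fix a b m d assume q: "uc_quad \<delta> a b m d"
    have *: "d powr t \<le> \<eta> * (a powr t + b powr t) + 2 powr t / c * ((a powr t + b powr t) / 2 - m powr t)"
      if q: "uc_quad \<delta> a b m d" and le: "b \<le> a" for a b
    proof -
      have nn: "0 \<le> a" "0 \<le> b" "0 \<le> m" "0 \<le> d" "m \<le> (a + b) / 2" "d \<le> a + b"
        using q by (auto simp: uc_quad_def)
      show ?thesis
      proof (cases "a = 0")
        case True
        then have "b = 0" "m = 0" "d = 0" using nn le by auto
        then show ?thesis using True by simp
      next
        case False
        then have a: "a > 0" using nn by simp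
        show ?thesis
        proof (cases "\<epsilon> * a \<le> d")
          case True
          define \<beta> where "\<beta> = b / a"
          have \<beta>: "\<beta> \<in> {0..1}" using a nn le by (auto simp: \<beta>_def)
          have b: "b = a * \<beta>" using a by (simp add: \<beta>_def)
          have "m \<le> (1 - \<delta> \<epsilon>) * a"
            using q True \<epsilon> le by (auto simp: uc_quad_def)
          also have "\<dots> \<le> \<kappa> * a" using a by (simp add: \<kappa>_def)
          finally have "m / a \<le> min ((1 + \<beta>) / 2) \<kappa>"
            using nn a by (simp add: field_simps b)
          then have "(m / a) powr t \<le> min ((1 + \<beta>) / 2) \<kappa> powr t"
            using nn a assms by (intro powr_mono2) auto
          then have "c \<le> (1 + \<beta> powr t) / 2 - m powr t / a powr t"
            using \<beta>0(2)[OF \<beta>] nn a by (simp add: c_def f_def powr_divide)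
          then have "a powr t * c \<le> a powr t * ((1 + \<beta> powr t) / 2 - m powr t / a powr t)"
            by (intro mult_left_mono) auto
          also have "\<dots> = (a powr t + b powr t) / 2 - m powr t"
            using a \<beta> by (simp add: b powr_mult algebra_simps)
          finally have 1: "a powr t * c \<le> (a powr t + b powr t) / 2 - m powr t" .
          have "d powr t \<le> (2 * a) powr t" using nn le assms by (intro powr_mono2) auto
          also have "\<dots> = 2 powr t / c * (a powr t * c)" using a c by (simp add: powr_mult)
          also have "\<dots> \<le> 2 powr t / c * ((a powr t + b powr t) / 2 - m powr t)"
            using 1 c by (intro mult_left_mono) auto
          finally show ?thesis using assms by (simp add: add_increasing)
        next
          case False
          then have "d powr t \<le> (\<epsilon> * a) powr t" using nn assms by (intro powr_mono2) auto
          also have "\<dots> = \<eta> * a powr t" using \<epsilon> a by (simp add: powr_mult)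
          also have "\<dots> \<le> \<eta> * (a powr t + b powr t)" using assms by simp
          finally have 1: "d powr t \<le> \<eta> * (a powr t + b powr t)" .
          have "m powr t \<le> ((a + b) / 2) powr t" using nn assms by (intro powr_mono2) auto
          also have "(a + b) / 2 = 1 / 2 * a + (1 - 1 / 2) * b" by simp
          also have "\<dots> powr t \<le> 1 / 2 * a powr t + (1 - 1 / 2) * b powr t"
            using nn assms by (intro powr_convex_combination) auto
          finally have "0 \<le> 2 powr t / c * ((a powr t + b powr t) / 2 - m powr t)"
            using c by simp
          then show ?thesis using 1 by simp
        qed
      qed
    qed
    show "d powr t \<le> \<eta> * (a powr t + b powr t) + 2 powr t / c * ((a powr t + b powr t) / 2 - m powr t)"
    proof (cases "b \<le> a")
      case False
      moreover have "uc_quad \<delta> b a m d" using q by (auto simp: uc_quad_def add.commute)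
      ultimately show ?thesis using *[of b a] by (simp add: add.commute)
    qed (use *[OF q] in simp)
  qed
qed

text \<open>Uniform convexity is inherited by \<open>L\<^sup>s\<close> norms. The new modulus depends on \<open>s\<close> and \<open>\<delta>\<close> only, in
  particular not on the measure.\<close>

theorem uc_quad_Lp_norm:
  fixes s :: real
  assumes "s > 1" and \<delta>: "\<And>\<epsilon>. \<epsilon> > 0 \<Longrightarrow> \<delta> \<epsilon> > 0"
  obtains \<delta>' where "\<And>\<epsilon>. \<epsilon> > 0 \<Longrightarrow> \<delta>' \<epsilon> > 0"
    and "\<And>(M :: 'w measure) f g m d. \<lbrakk>Lp_fun M s f; Lp_fun M s g; Lp_fun M s m; Lp_fun M s d;
      \<And>x. x \<in> space M \<Longrightarrow> uc_quad \<delta> (f x) (g x) (m x) (d x)\<rbrakk>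
      \<Longrightarrow> uc_quad \<delta>' (Lp_norm M s f) (Lp_norm M s g) (Lp_norm M s m) (Lp_norm M s d)"
proof -
  have "\<exists>C>0. \<forall>a b m d. uc_quad \<delta> a b m d \<longrightarrow>
    d powr s \<le> \<eta> * (a powr s + b powr s) + C * ((a powr s + b powr s) / 2 - m powr s)"
    if "\<eta> > 0" for \<eta>
  proof -
    obtain C where "C > 0" "\<And>a b m d. uc_quad \<delta> a b m d \<Longrightarrow>
      d powr s \<le> \<eta> * (a powr s + b powr s) + C * ((a powr s + b powr s) / 2 - m powr s)"
      using uc_quad_powr[where \<delta> = \<delta>, OF assms(1) \<delta> \<open>\<eta> > 0\<close>] by blast
    then show ?thesis by blast
  qed
  then obtain C where C: "\<And>\<eta>. \<eta> > 0 \<Longrightarrow> C \<eta> > 0"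
    "\<And>\<eta> a b m d. \<eta> > 0 \<Longrightarrow> uc_quad \<delta> a b m d \<Longrightarrow>
    d powr s \<le> \<eta> * (a powr s + b powr s) + C \<eta> * ((a powr s + b powr s) / 2 - m powr s)"
    by metis
  \<comment> \<open>with this \<open>\<eta>\<close>, the term \<open>\<eta> (k\<^sup>s + k\<^sup>s)\<close> absorbs half of the lower bound \<open>(\<epsilon> k)\<^sup>s\<close> for \<open>d\<^sup>s\<close>\<close>
  define \<eta> where "\<eta> = (\<lambda>\<epsilon>. \<epsilon> powr s / 4)"
  define \<kappa> where "\<kappa> = (\<lambda>\<epsilon>. max 0 (1 - \<epsilon> powr s / (2 * C (\<eta> \<epsilon>))))"
  define \<delta>' where "\<delta>' = (\<lambda>\<epsilon>. 1 - \<kappa> \<epsilon> powr (1 / s))"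
  have \<eta>: "\<eta> \<epsilon> > 0" if "\<epsilon> > 0" for \<epsilon> using that by (simp add: \<eta>_def)
  show ?thesis
  proof
    fix \<epsilon> :: real assume e: "\<epsilon> > 0"
    have "\<kappa> \<epsilon> < 1" using C(1)[OF \<eta>[OF e]] e by (simp add: \<kappa>_def)
    then have "\<kappa> \<epsilon> powr (1 / s) < 1 powr (1 / s)"
      using assms by (intro powr_less_mono2) (auto simp: \<kappa>_def)
    then show "\<delta>' \<epsilon> > 0" by (simp add: \<delta>'_def)
  next
    fix M :: "'w measure" and f g m d
    assume Lp: "Lp_fun M s f" "Lp_fun M s g" "Lp_fun M s m" "Lp_fun M s d"
      and q: "\<And>x. x \<in> space M \<Longrightarrow> uc_quad \<delta> (f x) (g x) (m x) (d x)"
    let ?A = "Lp_norm M s f" and ?B = "Lp_norm M s g" and ?M = "Lp_norm M s m" and ?D = "Lp_norm M s d"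
    have int: "integrable M (\<lambda>x. f x powr s)" "integrable M (\<lambda>x. g x powr s)"
      "integrable M (\<lambda>x. m x powr s)" "integrable M (\<lambda>x. d x powr s)"
      and meas: "m \<in> borel_measurable M" "d \<in> borel_measurable M"
      using Lp by (auto simp: Lp_fun_def)
    have qD: "0 \<le> m x" "0 \<le> d x" "m x \<le> 1 / 2 * f x + 1 / 2 * g x" "d x \<le> f x + g x"
      if "x \<in> space M" for x
    proof -
      have "0 \<le> m x \<and> 0 \<le> d x \<and> m x \<le> (f x + g x) / 2 \<and> d x \<le> f x + g x"
        using q[OF that] unfolding uc_quad_def by blast
      then show "0 \<le> m x" "0 \<le> d x" "m x \<le> 1 / 2 * f x + 1 / 2 * g x" "d x \<le> f x + g x"
        by (simp_all add: add_divide_distrib)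
    qed
    show "uc_quad \<delta>' ?A ?B ?M ?D"
      unfolding uc_quad_def
    proof (intro conjI allI impI)
      show "?D \<le> ?A + ?B"
        using qD assms(1) Lp meas by (intro Lp_triangle(2)) auto
      have "?M \<le> Lp_norm M s (\<lambda>x. 1 / 2 * f x) + Lp_norm M s (\<lambda>x. 1 / 2 * g x)"
      proof (rule Lp_triangle(2))
        show "m x \<le> 1 / 2 * f x + 1 / 2 * g x" if "x \<in> space M" for x
          using qD[OF that] by simp
      qed (use qD assms(1) meas Lp_scale(1)[OF _ _ Lp(1), of "1 / 2"] Lp_scale(1)[OF _ _ Lp(2), of "1 / 2"]
          in auto)
      also have "\<dots> = 1 / 2 * ?A + 1 / 2 * ?B"
        using assms(1) Lp by (intro arg_cong2[where f = "(+)"] Lp_scale(2)) auto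
      finally show "?M \<le> (?A + ?B) / 2" by simp
      fix \<epsilon> k :: real assume e: "\<epsilon> > 0" and k: "?A \<le> k \<and> ?B \<le> k \<and> \<epsilon> * k \<le> ?D"
      have kn: "0 \<le> k" using k Lp_norm_nonneg order_trans by blast
      let ?C = "C (\<eta> \<epsilon>)"
      have Cp: "?C > 0" using C \<eta> e by auto
      have "?D powr s = (LINT x|M. d x powr s)" using assms(1) by (simp add: Lp_norm_powr)
      also have "\<dots> \<le> (LINT x|M. \<eta> \<epsilon> * (f x powr s + g x powr s) +
           ?C * ((f x powr s + g x powr s) / 2 - m x powr s))"
        using int C(2)[OF \<eta>[OF e] q] by (intro integral_mono) auto
      also have "\<dots> = \<eta> \<epsilon> * (?A powr s + ?B powr s) + ?C * ((?A powr s + ?B powr s) / 2 - ?M powr s)"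
        using int assms(1) by (simp add: Lp_norm_powr)
      also have "\<dots> \<le> \<eta> \<epsilon> * (k powr s + k powr s) + ?C * ((k powr s + k powr s) / 2 - ?M powr s)"
        using k kn assms(1) Cp \<eta>[OF e] Lp_norm_nonneg
        by (intro add_mono mult_left_mono diff_mono divide_right_mono powr_mono2) auto
      finally have "?D powr s \<le> \<epsilon> powr s / 2 * k powr s + ?C * (k powr s - ?M powr s)"
        by (simp add: \<eta>_def)
      moreover have "\<epsilon> powr s * k powr s \<le> ?D powr s"
        using k kn e assms(1) powr_mono2[of s "\<epsilon> * k" ?D] by (simp add: powr_mult)
      ultimately have "?C * ?M powr s \<le> (?C - \<epsilon> powr s / 2) * k powr s"
        by (simp add: algebra_simps)
      then have "?M powr s \<le> (?C - \<epsilon> powr s / 2) * k powr s / ?C"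
        using Cp by (simp add: field_simps)
      also have "\<dots> = (1 - \<epsilon> powr s / (2 * ?C)) * k powr s"
        using Cp by (simp add: field_simps)
      also have "\<dots> \<le> \<kappa> \<epsilon> * k powr s" by (intro mult_right_mono) (auto simp: \<kappa>_def)
      finally have "(?M powr s) powr (1 / s) \<le> (\<kappa> \<epsilon> * k powr s) powr (1 / s)"
        using assms(1) by (intro powr_mono2) auto
      then show "?M \<le> (1 - \<delta>' \<epsilon>) * k"
        using assms(1) kn Lp_norm_nonneg[of M s m] by (simp add: powr_powr powr_mult \<kappa>_def \<delta>'_def)
    qed (auto simp: Lp_norm_nonneg)
  qed
qed

section \<open>Smooth functions with compact support\<close>

lemma GDERIV_unique:
  assumes "GDERIV f x :> D" "GDERIV f x :> D'"
  shows "D = D'"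
proof -
  have "(\<lambda>h. inner h D) = (\<lambda>h. inner h D')"
    using assms unfolding gderiv_def by (rule has_derivative_unique)
  then show ?thesis by (metis vector_eq_ldot)
qed

lemma GDERIV_continuous_on: "(\<And>x. GDERIV f x :> G x) \<Longrightarrow> continuous_on UNIV f"
  unfolding gderiv_def
  by (intro has_derivative_continuous_on[of _ _ "\<lambda>x h. inner h (G x)"]) auto

lemma Ck_fun_SucI:
  assumes "\<And>x. GDERIV f x :> G x" "\<And>i. i \<in> Basis \<Longrightarrow> Ck_fun k (\<lambda>x. G x \<bullet> i)"
  shows "Ck_fun (Suc k) f"
  using assms by auto

lemma Ck_fun_Suc_imp: "Ck_fun (Suc k) f \<Longrightarrow> Ck_fun k f"
proof (induction k arbitrary: f)
  case 0
  then show ?case by (auto intro: GDERIV_continuous_on)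
next
  case (Suc k)
  from Suc.prems obtain G where "\<And>x. GDERIV f x :> G x"
    "\<And>i. i \<in> Basis \<Longrightarrow> Ck_fun (Suc k) (\<lambda>x. G x \<bullet> i)"
    unfolding Ck_fun.simps(2)[of "Suc k"] by auto
  with Suc.IH show ?case by (intro Ck_fun_SucI) blast+
qed

lemma Ck_fun_const: "Ck_fun k (\<lambda>x. c)"
proof (induction k arbitrary: c)
  case (Suc k)
  show ?case by (rule Ck_fun_SucI[OF GDERIV_const]) (use Suc in simp)
qed simp

lemma Ck_fun_add: "Ck_fun k f \<Longrightarrow> Ck_fun k g \<Longrightarrow> Ck_fun k (\<lambda>x. f x + g x)"
proof (induction k arbitrary: f g)
  case 0
  then show ?case by (auto intro: continuous_intros)
next
  case (Suc k)
  from Suc.prems obtain F G where "\<forall>x. GDERIV f x :> F x" "\<forall>x. GDERIV g x :> G x"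
    "\<forall>i\<in>Basis. Ck_fun k (\<lambda>x. F x \<bullet> i)" "\<forall>i\<in>Basis. Ck_fun k (\<lambda>x. G x \<bullet> i)"
    unfolding Ck_fun.simps by blast
  then have *: "\<And>x. GDERIV f x :> F x" "\<And>x. GDERIV g x :> G x"
    "\<And>i. i \<in> Basis \<Longrightarrow> Ck_fun k (\<lambda>x. F x \<bullet> i)" "\<And>i. i \<in> Basis \<Longrightarrow> Ck_fun k (\<lambda>x. G x \<bullet> i)"
    by auto
  show ?case
    by (rule Ck_fun_SucI[OF GDERIV_add[OF *(1,2)]]) (use * Suc.IH in \<open>simp add: inner_add_left\<close>)
qed

lemma Ck_fun_mult: "Ck_fun k f \<Longrightarrow> Ck_fun k g \<Longrightarrow> Ck_fun k (\<lambda>x. f x * g x)"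
proof (induction k arbitrary: f g)
  case 0
  then show ?case by (auto intro: continuous_intros)
next
  case (Suc k)
  from Suc.prems obtain F G where "\<forall>x. GDERIV f x :> F x" "\<forall>x. GDERIV g x :> G x"
    "\<forall>i\<in>Basis. Ck_fun k (\<lambda>x. F x \<bullet> i)" "\<forall>i\<in>Basis. Ck_fun k (\<lambda>x. G x \<bullet> i)"
    unfolding Ck_fun.simps by blast
  then have *: "\<And>x. GDERIV f x :> F x" "\<And>x. GDERIV g x :> G x"
    "\<And>i. i \<in> Basis \<Longrightarrow> Ck_fun k (\<lambda>x. F x \<bullet> i)" "\<And>i. i \<in> Basis \<Longrightarrow> Ck_fun k (\<lambda>x. G x \<bullet> i)"
    by auto
  have "Ck_fun k f" "Ck_fun k g" using Suc.prems Ck_fun_Suc_imp by blast+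
  then show ?case
    by (intro Ck_fun_SucI[OF GDERIV_mult[OF *(1,2)]])
       (use * in \<open>simp add: inner_add_left Ck_fun_add Suc.IH\<close>)
qed

lemma Ck_fun_prod:
  assumes "finite I" "\<And>i. i \<in> I \<Longrightarrow> Ck_fun k (f i)"
  shows "Ck_fun k (\<lambda>x. \<Prod>i\<in>I. f i x)"
  using assms by (induction I rule: finite_induct) (auto simp: Ck_fun_const Ck_fun_mult)

text \<open>The functions \<open>t\<^bsup>-n\<^esup> exp (-1/t)\<close>, extended by \<open>0\<close> to \<open>t \<le> 0\<close>. They are closed under
  differentiation up to linear combinations, which is what makes \<open>flat_exp 0\<close> smooth.\<close>

definition flat_exp :: "nat \<Rightarrow> real \<Rightarrow> real" where
  "flat_exp n t = (if t > 0 then exp (- 1 / t) / t ^ n else 0)"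

lemma flat_exp_tendsto: "(flat_exp n \<longlongrightarrow> 0) (at_right 0)"
proof -
  have "((\<lambda>t::real. exp (- 1 / t) / t ^ n) \<longlongrightarrow> 0) (at_right 0)" by real_asymp
  moreover have "eventually (\<lambda>t. exp (- 1 / t) / t ^ n = flat_exp n t) (at_right (0::real))"
    by (auto simp: eventually_at_filter flat_exp_def intro!: always_eventually)
  ultimately show ?thesis by (rule Lim_transform_eventually)
qed

lemma DERIV_flat_exp:
  "DERIV (flat_exp n) t :> flat_exp (n + 2) t + - real n * flat_exp (n + 1) t"
proof (rule linorder_cases[of t 0])
  assume t: "t < 0"
  show ?thesis
  proof (rule DERIV_cong_ev[THEN iffD2, OF refl _ refl])
    show "eventually (\<lambda>x. flat_exp n x = 0) (nhds t)"
      using eventually_nhds_in_open[of "{..<0}" t, OF open_lessThan] t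
      by (auto elim!: eventually_mono simp: flat_exp_def)
  qed (use t in \<open>auto simp: flat_exp_def\<close>)
next
  assume t: "t > 0"
  show ?thesis
  proof (rule DERIV_cong_ev[THEN iffD2, OF refl _ refl])
    show "eventually (\<lambda>x. flat_exp n x = exp (- 1 / x) / x ^ n) (nhds t)"
      using eventually_nhds_in_open[of "{0<..}" t, OF open_greaterThan] t
      by (auto elim!: eventually_mono simp: flat_exp_def)
    show "DERIV (\<lambda>x. exp (- 1 / x) / x ^ n) t :> flat_exp (n + 2) t + - real n * flat_exp (n + 1) t"
    proof (cases n)
      case 0
      then show ?thesis
        using t by (auto intro!: derivative_eq_intros simp: flat_exp_def field_simps power2_eq_square)
    next
      case (Suc m)
      have "DERIV (\<lambda>x. exp (- 1 / x) / x ^ Suc m) t :>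
          (exp (- 1 / t) * (1 / t\<^sup>2) * t ^ Suc m - exp (- 1 / t) * (real (Suc m) * t ^ m)) / (t ^ Suc m * t ^ Suc m)"
      proof -
        have "DERIV (\<lambda>x. exp (- 1 / x)) t :> exp (- 1 / t) * (1 / t\<^sup>2)"
          using t by (auto intro!: derivative_eq_intros simp: power2_eq_square)
        from DERIV_divide[OF this DERIV_pow[of "Suc m"]] show ?thesis using t by simp
      qed
      also have "(exp (- 1 / t) * (1 / t\<^sup>2) * t ^ Suc m - exp (- 1 / t) * (real (Suc m) * t ^ m)) / (t ^ Suc m * t ^ Suc m)
          = flat_exp (n + 2) t + - real n * flat_exp (n + 1) t"
        using t by (simp add: flat_exp_def Suc power2_eq_square diff_divide_distrib mult.commute)
          (simp add: minus_divide_left algebra_simps del: divide_minus_left)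
      finally show ?thesis unfolding Suc .
    qed
  qed
next
  assume t: "t = 0"
  have "((\<lambda>h. (flat_exp n (0 + h) - flat_exp n 0) / h) \<longlongrightarrow> 0) (at_right 0)"
  proof (rule Lim_transform_eventually[OF flat_exp_tendsto[of "n + 1"]])
    show "eventually (\<lambda>h. flat_exp (n + 1) h = (flat_exp n (0 + h) - flat_exp n 0) / h) (at_right 0)"
      by (auto simp: eventually_at_filter flat_exp_def intro!: always_eventually)
  qed
  moreover have "((\<lambda>h. (flat_exp n (0 + h) - flat_exp n 0) / h) \<longlongrightarrow> 0) (at_left 0)"
  proof (rule Lim_transform_eventually[OF tendsto_const])
    show "eventually (\<lambda>h. 0 = (flat_exp n (0 + h) - flat_exp n 0) / h) (at_left 0)"
      by (auto simp: eventually_at_filter flat_exp_def intro!: always_eventually)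
  qed
  ultimately have "DERIV (flat_exp n) 0 :> 0"
    unfolding DERIV_def by (rule filterlim_split_at[rotated])
  then show ?thesis by (simp add: t flat_exp_def)
qed

lemma Ck_fun_flat_exp: "Ck_fun k (\<lambda>x::'a::euclidean_space. flat_exp n (c * (x \<bullet> v) + d))"
proof (induction k arbitrary: n)
  case 0
  have "continuous_on UNIV (flat_exp n)"
    by (rule DERIV_continuous_on[OF has_field_derivative_at_within[OF DERIV_flat_exp]])
  then have "continuous_on UNIV (flat_exp n \<circ> (\<lambda>x::'a. c * (x \<bullet> v) + d))"
    by (intro continuous_on_compose continuous_intros) (auto intro: continuous_on_subset)
  then show ?case by (simp add: o_def)
next
  case (Suc k)
  have lin: "GDERIV (\<lambda>x::'a. c * (x \<bullet> v) + d) x :> c *\<^sub>R v" for x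
    unfolding gderiv_def by (auto intro!: derivative_eq_intros)
  show ?case
  proof (rule Ck_fun_SucI[OF GDERIV_DERIV_compose[OF lin DERIV_flat_exp]])
    fix i :: 'a
    let ?l = "\<lambda>x::'a. c * (x \<bullet> v) + d"
    have "Ck_fun k (\<lambda>x. (flat_exp (n + 2) (?l x) + - real n * flat_exp (n + 1) (?l x)) * (c * (v \<bullet> i)))"
      by (intro Ck_fun_mult Ck_fun_add Ck_fun_const Suc)
    then show "Ck_fun k (\<lambda>x. ((flat_exp (n + 2) (?l x) + - real n * flat_exp (n + 1) (?l x)) *\<^sub>R c *\<^sub>R v) \<bullet> i)"
      by (simp only: inner_scaleR_left)
  qed
qed

text \<open>Smooth functions supported in a box that increase to its indicator function.\<close>

definition box_bump :: "'a \<Rightarrow> 'a \<Rightarrow> nat \<Rightarrow> 'a::euclidean_space \<Rightarrow> real" where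
  "box_bump a b n x = (\<Prod>i\<in>Basis. flat_exp 0 (real n * (x \<bullet> i) + - real n * (a \<bullet> i)) *
     flat_exp 0 (- real n * (x \<bullet> i) + real n * (b \<bullet> i)))"

lemma box_bump_bounds: "0 \<le> box_bump a b n x" "box_bump a b n x \<le> 1"
proof -
  have "0 \<le> flat_exp 0 t" "flat_exp 0 t \<le> 1" for t by (auto simp: flat_exp_def)
  then show "0 \<le> box_bump a b n x" "box_bump a b n x \<le> 1"
    unfolding box_bump_def by (auto intro!: prod_nonneg prod_le_1 mult_le_one)
qed

lemma box_bump_eq_0:
  assumes "x \<notin> box a b"
  shows "box_bump a b n x = 0"
proof -
  from assms obtain i where i: "i \<in> Basis" "x \<bullet> i \<le> a \<bullet> i \<or> b \<bullet> i \<le> x \<bullet> i"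
    by (auto simp: mem_box not_less)
  then have "real n * (x \<bullet> i) \<le> real n * (a \<bullet> i) \<or> real n * (b \<bullet> i) \<le> real n * (x \<bullet> i)"
    by (auto intro: mult_left_mono)
  then show ?thesis
    unfolding box_bump_def
    by (intro prod_zero finite_Basis bexI[OF _ i(1)]) (auto simp: flat_exp_def)
qed

lemma box_bump_tendsto: "(\<lambda>n. box_bump a b n x) \<longlonglongrightarrow> indicator (box a b) x"
proof (cases "x \<in> box a b")
  case True
  have lim: "(\<lambda>n. flat_exp 0 (real n * t)) \<longlonglongrightarrow> 1" if "t > 0" for t
  proof -
    have "(\<lambda>n. exp (- 1 / (real n * t))) \<longlonglongrightarrow> 1" using that by real_asymp
    moreover have "eventually (\<lambda>n. exp (- 1 / (real n * t)) = flat_exp 0 (real n * t)) sequentially"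
      using eventually_gt_at_top[of 0] by eventually_elim (use that in \<open>auto simp: flat_exp_def\<close>)
    ultimately show ?thesis by (rule Lim_transform_eventually)
  qed
  have "(\<lambda>n. \<Prod>i\<in>Basis. flat_exp 0 (real n * (x \<bullet> i - a \<bullet> i)) * flat_exp 0 (real n * (b \<bullet> i - x \<bullet> i)))
      \<longlonglongrightarrow> (\<Prod>i\<in>(Basis :: 'a set). 1 * 1)"
    using True by (intro tendsto_prod tendsto_mult lim) (auto simp: mem_box)
  then show ?thesis using True by (simp add: box_bump_def algebra_simps)
qed (simp add: box_bump_eq_0)

lemma test_function_box_bump: "test_function (box_bump a b n)"
proof -
  have "Ck_fun k (box_bump a b n)" for k
    unfolding box_bump_def[abs_def]
    by (intro Ck_fun_prod Ck_fun_mult Ck_fun_flat_exp) auto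
  moreover have "closure {x. box_bump a b n x \<noteq> 0} \<subseteq> cbox a b"
    using box_bump_eq_0 box_subset_cbox by (intro closure_minimal) blast+
  then have "compact (closure {x. box_bump a b n x \<noteq> 0})"
    by (meson bounded_subset bounded_cbox compact_eq_bounded_closed closed_closure)
  ultimately show ?thesis by (simp add: test_function_def)
qed

lemma test_functionE:
  assumes "test_function \<phi>"
  obtains D\<phi> where "\<And>x. GDERIV \<phi> x :> D\<phi> x"
proof -
  have "Ck_fun (Suc 0) \<phi>" using assms by (auto simp only: test_function_def)
  then show thesis using that by auto
qed

text \<open>A test function and its gradient are continuous, bounded and supported in a common compact set.\<close>

lemma test_function_bounds:
  assumes "test_function \<phi>" "\<And>x. GDERIV \<phi> x :> D\<phi> x"
  obtains K B where "compact K" "\<And>x. \<bar>\<phi> x\<bar> \<le> B * indicator K x"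
    "\<And>x. norm (D\<phi> x) \<le> B * indicator K x" "continuous_on UNIV \<phi>" "continuous_on UNIV D\<phi>"
proof -
  define K where "K = closure {x. \<phi> x \<noteq> 0}"
  have K: "compact K" using assms by (simp add: K_def test_function_def)
  have c: "continuous_on UNIV \<phi>" using assms(2) by (rule GDERIV_continuous_on)
  have "Ck_fun (Suc 0) \<phi>" using assms by (auto simp only: test_function_def)
  then obtain G where G: "\<And>x. GDERIV \<phi> x :> G x" "\<And>i. i \<in> Basis \<Longrightarrow> continuous_on UNIV (\<lambda>x. G x \<bullet> i)"
    by auto
  then have "D\<phi> = G" using assms(2) GDERIV_unique by blast
  then have cD: "continuous_on UNIV D\<phi>" using G(2) by (intro continuous_on_componentwise[THEN iffD2]) auto
  have 0: "\<phi> x = 0" if "x \<notin> K" for x using that closure_subset[of "{x. \<phi> x \<noteq> 0}"] by (auto simp: K_def)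
  have D0: "D\<phi> x = 0" if "x \<notin> K" for x
  proof (rule GDERIV_unique[OF assms(2)])
    have "((\<lambda>x. 0) has_derivative (\<lambda>h. h \<bullet> 0)) (at x)" by simp
    then show "GDERIV \<phi> x :> 0"
      unfolding gderiv_def
      by (rule has_derivative_transform_within_open[of _ _ _ _ "- K"])
         (use that K 0 in \<open>auto simp: compact_imp_closed\<close>)
  qed
  have "bounded (\<phi> ` K)" "bounded (D\<phi> ` K)"
    using K c cD by (auto intro!: compact_imp_bounded compact_continuous_image intro: continuous_on_subset)
  then obtain B1 B2 where B: "\<And>x. x \<in> K \<Longrightarrow> \<bar>\<phi> x\<bar> \<le> B1" "\<And>x. x \<in> K \<Longrightarrow> norm (D\<phi> x) \<le> B2"
    unfolding bounded_iff by auto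
  show thesis
  proof (rule that[of K "max B1 B2"])
    show "\<bar>\<phi> x\<bar> \<le> max B1 B2 * indicator K x" for x
      using B(1)[of x] 0[of x] by (cases "x \<in> K") auto
    show "norm (D\<phi> x) \<le> max B1 B2 * indicator K x" for x
      using B(2)[of x] D0[of x] by (cases "x \<in> K") auto
  qed (use K c cD in auto)
qed

section \<open>Weak gradients\<close>

lemma locally_integrable_measurable:
  fixes u :: "'a::euclidean_space \<Rightarrow> 'b::euclidean_space"
  assumes "locally_integrable u"
  shows "u \<in> borel_measurable lebesgue"
proof (rule borel_measurable_LIMSEQ_metric)
  show "(\<lambda>x. indicator (cball 0 (real n)) x *\<^sub>R u x) \<in> borel_measurable lebesgue" for n
    using assms compact_cball[of 0 "real n"] borel_measurable_integrable
    unfolding locally_integrable_def set_integrable_def by blast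
  show "(\<lambda>n. indicator (cball 0 (real n)) x *\<^sub>R u x) \<longlonglongrightarrow> u x" for x
  proof (rule tendsto_eventually)
    obtain n0 where n0: "norm x \<le> real n0" using real_arch_simple by blast
    show "eventually (\<lambda>n. indicator (cball 0 (real n)) x *\<^sub>R u x = u x) sequentially"
      using eventually_ge_at_top[of n0] by eventually_elim (use n0 in auto)
  qed
qed

lemma borel_measurable_lebesgue_continuous:
  fixes f :: "'a::euclidean_space \<Rightarrow> 'b::euclidean_space"
  shows "continuous_on UNIV f \<Longrightarrow> f \<in> borel_measurable lebesgue"
  by (intro measurable_completion) (simp add: borel_measurable_continuous_onI)

lemma locally_integrable_norm:
  assumes "locally_integrable u" "compact K"
  shows "integrable lebesgue (\<lambda>x. indicator K x * norm (u x))"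
proof -
  have "integrable lebesgue (\<lambda>x. norm (indicator K x *\<^sub>R u x))"
    using assms unfolding locally_integrable_def set_integrable_def by (intro integrable_norm) auto
  then show ?thesis by (simp add: indicator_def if_distrib cong: if_cong)
qed

lemma integrable_local_bound:
  fixes u :: "'a::euclidean_space \<Rightarrow> 'b::euclidean_space"
    and h :: "'a::euclidean_space \<Rightarrow> 'c::euclidean_space"
  assumes "locally_integrable u" "compact K" "h \<in> borel_measurable lebesgue"
    "\<And>x. norm (h x) \<le> B * (indicator K x * norm (u x))"
  shows "integrable lebesgue h"
    "norm (LINT x|lebesgue. h x) \<le> B * (LINT x|lebesgue. indicator K x * norm (u x))"
proof -
  have u: "integrable lebesgue (\<lambda>x. B * (indicator K x * norm (u x)))"
    using locally_integrable_norm[OF assms(1,2)] by simp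
  show h: "integrable lebesgue h"
    by (rule Bochner_Integration.integrable_bound[OF u assms(3)])
       (use assms(4) in \<open>auto intro!: AE_I2 order_trans[OF _ abs_ge_self]\<close>)
  have "norm (LINT x|lebesgue. h x) \<le> (LINT x|lebesgue. norm (h x))" by simp
  also have "\<dots> \<le> (LINT x|lebesgue. B * (indicator K x * norm (u x)))"
    using u h assms(4) by (intro integral_mono) auto
  finally show "norm (LINT x|lebesgue. h x) \<le> B * (LINT x|lebesgue. indicator K x * norm (u x))"
    by simp
qed

text \<open>Both sides of the identity that defines weak gradients are integrals of integrable functions, and
  they depend continuously on \<open>u\<close> and \<open>G\<close> with respect to convergence in \<open>L\<^sup>1\<close> on one compact set.\<close>

lemma test_function_pairing:
  fixes \<phi> :: "'a::euclidean_space \<Rightarrow> real"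
  assumes "test_function \<phi>" "\<And>x. GDERIV \<phi> x :> D\<phi> x"
  obtains K B where "compact K"
    "\<And>u::'a \<Rightarrow> real. locally_integrable u \<Longrightarrow> integrable lebesgue (\<lambda>x. u x *\<^sub>R D\<phi> x)"
    "\<And>G::'a \<Rightarrow> 'a. locally_integrable G \<Longrightarrow> integrable lebesgue (\<lambda>x. \<phi> x *\<^sub>R G x)"
    "\<And>u::'a \<Rightarrow> real. locally_integrable u \<Longrightarrow> norm (LINT x|lebesgue. u x *\<^sub>R D\<phi> x)
      \<le> B * (LINT x|lebesgue. indicator K x * norm (u x))"
    "\<And>G::'a \<Rightarrow> 'a. locally_integrable G \<Longrightarrow> norm (LINT x|lebesgue. \<phi> x *\<^sub>R G x)
      \<le> B * (LINT x|lebesgue. indicator K x * norm (G x))"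
proof -
  obtain K B where K: "compact K" and B: "\<And>x. \<bar>\<phi> x\<bar> \<le> B * indicator K x"
    "\<And>x. norm (D\<phi> x) \<le> B * indicator K x" and c: "continuous_on UNIV \<phi>" "continuous_on UNIV D\<phi>"
    using test_function_bounds[OF assms] by metis
  have [measurable]: "\<phi> \<in> borel_measurable lebesgue" "D\<phi> \<in> borel_measurable lebesgue"
    using c by (auto intro: borel_measurable_lebesgue_continuous)
  have bu: "norm (u x *\<^sub>R D\<phi> x) \<le> B * (indicator K x * norm (u x))" for u :: "'a \<Rightarrow> real" and x
    using mult_left_mono[OF B(2)[of x], of "\<bar>u x\<bar>"] by (simp add: mult_ac)
  have bG: "norm (\<phi> x *\<^sub>R G x) \<le> B * (indicator K x * norm (G x))" for G :: "'a \<Rightarrow> 'a" and x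
    using mult_right_mono[OF B(1)[of x], of "norm (G x)"] by (simp add: mult_ac)
  have mu: "(\<lambda>x. u x *\<^sub>R D\<phi> x) \<in> borel_measurable lebesgue" if "locally_integrable u" for u :: "'a \<Rightarrow> real"
    using locally_integrable_measurable[OF that] by simp
  have mG: "(\<lambda>x. \<phi> x *\<^sub>R G x) \<in> borel_measurable lebesgue" if "locally_integrable G" for G :: "'a \<Rightarrow> 'a"
    using locally_integrable_measurable[OF that] by simp
  show thesis
  proof (rule that[OF K])
    fix u :: "'a \<Rightarrow> real" assume u: "locally_integrable u"
    show "integrable lebesgue (\<lambda>x. u x *\<^sub>R D\<phi> x)"
      "norm (LINT x|lebesgue. u x *\<^sub>R D\<phi> x) \<le> B * (LINT x|lebesgue. indicator K x * norm (u x))"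
      by (rule integrable_local_bound[OF u K mu[OF u]], rule bu)+
  next
    fix G :: "'a \<Rightarrow> 'a" assume G: "locally_integrable G"
    show "integrable lebesgue (\<lambda>x. \<phi> x *\<^sub>R G x)"
      "norm (LINT x|lebesgue. \<phi> x *\<^sub>R G x) \<le> B * (LINT x|lebesgue. indicator K x * norm (G x))"
      by (rule integrable_local_bound[OF G K mG[OF G]], rule bG)+
  qed
qed

lemma locally_integrable_lincomb:
  fixes u v :: "'a::euclidean_space \<Rightarrow> 'b::euclidean_space"
  assumes "locally_integrable u" "locally_integrable v"
  shows "locally_integrable (\<lambda>x. a *\<^sub>R u x + b *\<^sub>R v x)"
  using assms unfolding locally_integrable_def by (auto intro!: set_integral_add(1) set_integrable_scaleR_right)

lemma has_weak_gradient_lincomb: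
  fixes u v :: "'a::euclidean_space \<Rightarrow> real"
  assumes "has_weak_gradient u G" "has_weak_gradient v H"
  shows "has_weak_gradient (\<lambda>x. a * u x + b * v x) (\<lambda>x. a *\<^sub>R G x + b *\<^sub>R H x)"
  unfolding has_weak_gradient_def
proof (intro conjI allI impI)
  have li: "locally_integrable u" "locally_integrable v" "locally_integrable G" "locally_integrable H"
    using assms by (auto simp: has_weak_gradient_def)
  show "locally_integrable (\<lambda>x. a * u x + b * v x)" "locally_integrable (\<lambda>x. a *\<^sub>R G x + b *\<^sub>R H x)"
    using locally_integrable_lincomb[OF li(1,2)] locally_integrable_lincomb[OF li(3,4)] by simp_all
  fix \<phi> :: "'a \<Rightarrow> real" and D\<phi> assume \<phi>: "test_function \<phi> \<and> (\<forall>x. GDERIV \<phi> x :> D\<phi> x)"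
  then have \<phi>': "test_function \<phi>" "\<And>x. GDERIV \<phi> x :> D\<phi> x" by auto
  have int:
    "\<And>u::'a \<Rightarrow> real. locally_integrable u \<Longrightarrow> integrable lebesgue (\<lambda>x. u x *\<^sub>R D\<phi> x)"
    "\<And>G::'a \<Rightarrow> 'a. locally_integrable G \<Longrightarrow> integrable lebesgue (\<lambda>x. \<phi> x *\<^sub>R G x)"
    by (rule test_function_pairing[OF \<phi>']; blast)+
  have "(LINT x|lebesgue. (a * u x + b * v x) *\<^sub>R D\<phi> x)
      = (LINT x|lebesgue. a *\<^sub>R (u x *\<^sub>R D\<phi> x) + b *\<^sub>R (v x *\<^sub>R D\<phi> x))"
    by (simp only: scaleR_add_left scaleR_scaleR)
  also have "\<dots> = a *\<^sub>R (LINT x|lebesgue. u x *\<^sub>R D\<phi> x) + b *\<^sub>R (LINT x|lebesgue. v x *\<^sub>R D\<phi> x)"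
    using int(1)[OF li(1)] int(1)[OF li(2)]
    by (simp del: scaleR_scaleR)
  also have "\<dots> = - (a *\<^sub>R (LINT x|lebesgue. \<phi> x *\<^sub>R G x) + b *\<^sub>R (LINT x|lebesgue. \<phi> x *\<^sub>R H x))"
    using assms \<phi> by (simp add: has_weak_gradient_def)
  also have "a *\<^sub>R (LINT x|lebesgue. \<phi> x *\<^sub>R G x) + b *\<^sub>R (LINT x|lebesgue. \<phi> x *\<^sub>R H x)
      = (LINT x|lebesgue. a *\<^sub>R (\<phi> x *\<^sub>R G x) + b *\<^sub>R (\<phi> x *\<^sub>R H x))"
    using int(2)[OF li(3)] int(2)[OF li(4)]
    by (simp del: scaleR_scaleR)
  also have "\<dots> = (LINT x|lebesgue. \<phi> x *\<^sub>R (a *\<^sub>R G x + b *\<^sub>R H x))"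
    by (simp add: scaleR_add_right mult.commute)
  finally show "(LINT x|lebesgue. (a * u x + b * v x) *\<^sub>R D\<phi> x)
      = - (LINT x|lebesgue. \<phi> x *\<^sub>R (a *\<^sub>R G x + b *\<^sub>R H x))" .
qed

lemma locally_integrable_cong_AE:
  fixes u v :: "'a::euclidean_space \<Rightarrow> 'b::euclidean_space"
  assumes "locally_integrable u" "AE x in lebesgue. u x = v x"
  shows "locally_integrable v"
  unfolding locally_integrable_def set_integrable_def
proof (intro allI impI)
  fix K :: "'a set" assume K: "compact K"
  have mu: "u \<in> borel_measurable lebesgue" using assms(1) by (rule locally_integrable_measurable)
  have mv: "v \<in> borel_measurable lebesgue"
    by (rule borel_measurable_AE[OF mu assms(2)])
  have K': "K \<in> sets lebesgue" using K by (simp add: compact_imp_closed borel_closed)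
  have "integrable lebesgue (\<lambda>x. indicator K x *\<^sub>R u x)"
    using assms K by (auto simp: locally_integrable_def set_integrable_def)
  then show "integrable lebesgue (\<lambda>x. indicator K x *\<^sub>R v x)"
  proof (rule integrable_cong_AE_imp)
    show "(\<lambda>x. indicator K x *\<^sub>R v x) \<in> borel_measurable lebesgue"
      using mv K' by (intro borel_measurable_scaleR borel_measurable_indicator) auto
    show "AE x in lebesgue. indicator K x *\<^sub>R u x = indicator K x *\<^sub>R v x"
      using assms(2) by eventually_elim simp
  qed
qed

lemma has_weak_gradient_cong_AE:
  fixes u v :: "'a::euclidean_space \<Rightarrow> real"
  assumes "has_weak_gradient u G" "AE x in lebesgue. u x = v x"
  shows "has_weak_gradient v G"
proof -
  have u: "locally_integrable u" and G: "locally_integrable G"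
    using assms(1) by (auto simp: has_weak_gradient_def)
  have v: "locally_integrable v" by (rule locally_integrable_cong_AE[OF u assms(2)])
  show ?thesis
    unfolding has_weak_gradient_def
  proof (intro conjI allI impI u v G)
    fix \<phi> :: "'a \<Rightarrow> real" and D\<phi> assume \<phi>: "test_function \<phi> \<and> (\<forall>x. GDERIV \<phi> x :> D\<phi> x)"
    then have \<phi>': "test_function \<phi>" "\<And>x. GDERIV \<phi> x :> D\<phi> x" by auto
    have int:
      "\<And>u::'a \<Rightarrow> real. locally_integrable u \<Longrightarrow> integrable lebesgue (\<lambda>x. u x *\<^sub>R D\<phi> x)"
      by (rule test_function_pairing[OF \<phi>']; blast)
    have "(LINT x|lebesgue. v x *\<^sub>R D\<phi> x) = (LINT x|lebesgue. u x *\<^sub>R D\<phi> x)"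
      using assms(2) int[OF u] int[OF v] by (intro integral_cong_AE) auto
    then show "(LINT x|lebesgue. v x *\<^sub>R D\<phi> x) = - (LINT x|lebesgue. \<phi> x *\<^sub>R G x)"
      using assms(1) \<phi> by (simp add: has_weak_gradient_def)
  qed
qed

text \<open>This follows from Lebesgue's differentiation theorem along cubes with a corner at the point.\<close>

lemma AE_zero_if_box_integrals_zero:
  fixes f :: "'a::euclidean_space \<Rightarrow> 'b::euclidean_space"
  assumes "\<And>a b. f integrable_on cbox a b" "\<And>a b. integral (cbox a b) f = 0"
  shows "AE x in lebesgue. f x = 0"
proof -
  obtain N where N: "negligible N" "\<And>x e. \<lbrakk>x \<notin> N; 0 < e\<rbrakk> \<Longrightarrow> \<exists>d>0. \<forall>h. 0 < h \<and> h < d \<longrightarrow>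
      norm (integral (cbox x (x + h *\<^sub>R One)) f /\<^sub>R h ^ DIM('a) - f x) < e"
    using integrable_ccontinuous_explicit[OF assms(1)] by blast
  have "f x = 0" if x: "x \<notin> N" for x
  proof (rule ccontr)
    assume "f x \<noteq> 0"
    then obtain d where d: "d > 0" "\<And>h. 0 < h \<and> h < d \<Longrightarrow>
        norm (integral (cbox x (x + h *\<^sub>R One)) f /\<^sub>R h ^ DIM('a) - f x) < norm (f x)"
      using N(2)[OF x, of "norm (f x)"] by auto
    from d(2)[of "d / 2"] d(1) assms(2) show False by simp
  qed
  then have "{x. f x \<noteq> 0} \<subseteq> N" by auto
  moreover have "N \<in> null_sets lebesgue" using N(1) by (simp add: negligible_iff_null_sets)
  ultimately show ?thesis by (intro AE_I'[of N]) auto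
qed

text \<open>Dominated convergence along \<open>box_bump\<close> reduces the claim to integrals over boxes.\<close>

lemma fundamental_lemma_calculus_of_variations:
  fixes F :: "'a::euclidean_space \<Rightarrow> 'b::euclidean_space"
  assumes F: "locally_integrable F"
    and 0: "\<And>\<phi>. test_function \<phi> \<Longrightarrow> (LINT x|lebesgue. \<phi> x *\<^sub>R F x) = 0"
  shows "AE x in lebesgue. F x = 0"
proof (rule AE_zero_if_box_integrals_zero)
  fix a b :: 'a
  have abs: "F absolutely_integrable_on cbox a b" using F by (auto simp: locally_integrable_def)
  then show "F integrable_on cbox a b" by (rule set_lebesgue_integral_eq_integral(1))
  have m[measurable]: "F \<in> borel_measurable lebesgue" using F by (rule locally_integrable_measurable)
  have "(\<lambda>n. LINT x|lebesgue. box_bump a b n x *\<^sub>R F x)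
      \<longlonglongrightarrow> (LINT x|lebesgue. indicator (box a b) x *\<^sub>R F x)"
  proof (rule integral_dominated_convergence)
    show "integrable lebesgue (\<lambda>x. indicator (cbox a b) x * norm (F x))"
      by (rule locally_integrable_norm[OF F compact_cbox])
    show "(\<lambda>x. indicator (box a b) x *\<^sub>R F x) \<in> borel_measurable lebesgue"
      by (intro borel_measurable_scaleR borel_measurable_indicator m) simp
    fix n
    obtain D where "\<And>x. GDERIV (box_bump a b n) x :> D x"
      using test_functionE[OF test_function_box_bump] by metis
    then have "box_bump a b n \<in> borel_measurable lebesgue"
      by (intro borel_measurable_lebesgue_continuous GDERIV_continuous_on)
    then show "(\<lambda>x. box_bump a b n x *\<^sub>R F x) \<in> borel_measurable lebesgue" by simp
    show "AE x in lebesgue. norm (box_bump a b n x *\<^sub>R F x) \<le> indicator (cbox a b) x * norm (F x)"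
    proof (intro AE_I2)
      fix x
      have "box_bump a b n x \<le> indicator (cbox a b) x"
        using box_bump_bounds(2)[of a b n x] box_bump_eq_0[of x a b n] box_subset_cbox[of a b]
        by (cases "x \<in> box a b") (auto simp: indicator_def)
      then show "norm (box_bump a b n x *\<^sub>R F x) \<le> indicator (cbox a b) x * norm (F x)"
        using box_bump_bounds(1)[of a b n x] by (auto intro: mult_right_mono)
    qed
  qed (auto intro!: AE_I2 tendsto_intros box_bump_tendsto)
  then have "(\<lambda>n::nat. 0) \<longlonglongrightarrow> (LINT x|lebesgue. indicator (box a b) x *\<^sub>R F x)"
    by (simp add: 0 test_function_box_bump)
  then have box0: "(LINT x|lebesgue. indicator (box a b) x *\<^sub>R F x) = 0"
    by (simp add: LIMSEQ_const_iff)
  have absb: "F absolutely_integrable_on box a b"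
    using abs by (rule set_integrable_subset) (auto simp: box_subset_cbox)
  have "integral (cbox a b) F = integral (box a b) F"
    by (simp add: integral_open_interval)
  also have "\<dots> = 0"
    using set_lebesgue_integral_eq_integral(2)[OF absb] box0 by (simp add: set_lebesgue_integral_def)
  finally show "integral (cbox a b) F = 0" .
qed

lemma weak_gradient_unique:
  fixes u :: "'a::euclidean_space \<Rightarrow> real"
  assumes "has_weak_gradient u G" "has_weak_gradient u H"
  shows "AE x in lebesgue. G x = H x"
proof -
  have 0: "has_weak_gradient (\<lambda>x. 0) (\<lambda>x. G x - H x)"
    using has_weak_gradient_lincomb[OF assms, of 1 "-1"] by simp
  have "AE x in lebesgue. G x - H x = 0"
  proof (rule fundamental_lemma_calculus_of_variations)
    fix \<phi> :: "'a \<Rightarrow> real" assume \<phi>: "test_function \<phi>"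
    then obtain D where "\<And>x. GDERIV \<phi> x :> D x" using test_functionE by metis
    then show "(LINT x|lebesgue. \<phi> x *\<^sub>R (G x - H x)) = 0"
      using 0 \<phi> unfolding has_weak_gradient_def by fastforce
  qed (use 0 in \<open>auto simp: has_weak_gradient_def\<close>)
  then show ?thesis by simp
qed

lemma has_weak_gradient_weak_gradient:
  "weakly_differentiable u \<Longrightarrow> has_weak_gradient u (weak_gradient u)"
  unfolding weakly_differentiable_def weak_gradient_def by (rule someI_ex[of "has_weak_gradient u"])

lemma has_weak_gradient_limit:
  fixes u :: "'a::euclidean_space \<Rightarrow> real" and uk :: "nat \<Rightarrow> 'a \<Rightarrow> real"
  assumes uk: "\<And>k. has_weak_gradient (uk k) (Gk k)"
    and u: "locally_integrable u" and G: "locally_integrable G"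
    and lim_u: "\<And>K. compact K \<Longrightarrow> (\<lambda>k. LINT x|lebesgue. indicator K x * norm (uk k x - u x)) \<longlonglongrightarrow> 0"
    and lim_G: "\<And>K. compact K \<Longrightarrow> (\<lambda>k. LINT x|lebesgue. indicator K x * norm (Gk k x - G x)) \<longlonglongrightarrow> 0"
  shows "has_weak_gradient u G"
  unfolding has_weak_gradient_def
proof (intro conjI allI impI u G)
  fix \<phi> :: "'a \<Rightarrow> real" and D\<phi> assume \<phi>: "test_function \<phi> \<and> (\<forall>x. GDERIV \<phi> x :> D\<phi> x)"
  then have \<phi>': "test_function \<phi>" "\<And>x. GDERIV \<phi> x :> D\<phi> x" by auto
  have uk': "locally_integrable (uk k)" "locally_integrable (Gk k)" for k
    using uk[of k] by (auto simp: has_weak_gradient_def)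
  have duk: "locally_integrable (\<lambda>x. uk k x - u x)" "locally_integrable (\<lambda>x. Gk k x - G x)" for k
    using locally_integrable_lincomb[OF uk'(1) u, where a = 1 and b = "-1"]
      locally_integrable_lincomb[OF uk'(2) G, where a = 1 and b = "-1"] by simp_all
  show "(LINT x|lebesgue. u x *\<^sub>R D\<phi> x) = - (LINT x|lebesgue. \<phi> x *\<^sub>R G x)"
  proof (rule test_function_pairing[OF \<phi>'])
    fix K B assume K: "compact K" and int:
      "\<And>u::'a \<Rightarrow> real. locally_integrable u \<Longrightarrow> integrable lebesgue (\<lambda>x. u x *\<^sub>R D\<phi> x)"
      "\<And>G::'a \<Rightarrow> 'a. locally_integrable G \<Longrightarrow> integrable lebesgue (\<lambda>x. \<phi> x *\<^sub>R G x)"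
      and bd: "\<And>u::'a \<Rightarrow> real. locally_integrable u \<Longrightarrow> norm (LINT x|lebesgue. u x *\<^sub>R D\<phi> x)
        \<le> B * (LINT x|lebesgue. indicator K x * norm (u x))"
      "\<And>G::'a \<Rightarrow> 'a. locally_integrable G \<Longrightarrow> norm (LINT x|lebesgue. \<phi> x *\<^sub>R G x)
        \<le> B * (LINT x|lebesgue. indicator K x * norm (G x))"
    have "(\<lambda>k. (LINT x|lebesgue. uk k x *\<^sub>R D\<phi> x) - (LINT x|lebesgue. u x *\<^sub>R D\<phi> x)) \<longlonglongrightarrow> 0"
    proof (rule Lim_null_comparison)
      show "eventually (\<lambda>k. norm ((LINT x|lebesgue. uk k x *\<^sub>R D\<phi> x) - (LINT x|lebesgue. u x *\<^sub>R D\<phi> x))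
        \<le> B * (LINT x|lebesgue. indicator K x * norm (uk k x - u x))) sequentially"
        using bd(1)[OF duk(1)] int(1) u uk' by (simp add: scaleR_diff_left)
      show "(\<lambda>k. B * (LINT x|lebesgue. indicator K x * norm (uk k x - u x))) \<longlonglongrightarrow> 0"
        using tendsto_mult_left[OF lim_u[OF K], of B] by simp
    qed
    then have 1: "(\<lambda>k. LINT x|lebesgue. uk k x *\<^sub>R D\<phi> x) \<longlonglongrightarrow> (LINT x|lebesgue. u x *\<^sub>R D\<phi> x)"
      by (simp add: LIM_zero_iff)
    have "(\<lambda>k. (LINT x|lebesgue. \<phi> x *\<^sub>R Gk k x) - (LINT x|lebesgue. \<phi> x *\<^sub>R G x)) \<longlonglongrightarrow> 0"
    proof (rule Lim_null_comparison)
      show "eventually (\<lambda>k. norm ((LINT x|lebesgue. \<phi> x *\<^sub>R Gk k x) - (LINT x|lebesgue. \<phi> x *\<^sub>R G x))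
        \<le> B * (LINT x|lebesgue. indicator K x * norm (Gk k x - G x))) sequentially"
        using bd(2)[OF duk(2)] int(2) G uk' by (simp add: scaleR_diff_right)
      show "(\<lambda>k. B * (LINT x|lebesgue. indicator K x * norm (Gk k x - G x))) \<longlonglongrightarrow> 0"
        using tendsto_mult_left[OF lim_G[OF K], of B] by simp
    qed
    then have "(\<lambda>k. LINT x|lebesgue. \<phi> x *\<^sub>R Gk k x) \<longlonglongrightarrow> (LINT x|lebesgue. \<phi> x *\<^sub>R G x)"
      by (simp add: LIM_zero_iff)
    then have "(\<lambda>k. - (LINT x|lebesgue. \<phi> x *\<^sub>R Gk k x)) \<longlonglongrightarrow> - (LINT x|lebesgue. \<phi> x *\<^sub>R G x)"
      by (rule tendsto_minus)
    moreover have "(\<lambda>k. - (LINT x|lebesgue. \<phi> x *\<^sub>R Gk k x)) = (\<lambda>k. LINT x|lebesgue. uk k x *\<^sub>R D\<phi> x)"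
      using uk \<phi> by (auto simp: has_weak_gradient_def)
    ultimately show "(LINT x|lebesgue. u x *\<^sub>R D\<phi> x) = - (LINT x|lebesgue. \<phi> x *\<^sub>R G x)"
      using 1 LIMSEQ_unique by metis
  qed
qed

section \<open>Ball masses as iterated norms\<close>

text \<open>The \<open>L\<^sup>p\<close> norm on the ball of radius \<open>\<rho>\<close> about the origin, that is, the power \<open>1 / p\<close> of the ball
  mass when the latter is finite.\<close>

definition ball_norm :: "real \<Rightarrow> ('a::euclidean_space \<Rightarrow> real) \<Rightarrow> real \<Rightarrow> real" where
  "ball_norm p u \<rho> = Lp_norm (lebesgue_on (ball 0 \<rho>)) p (\<lambda>y. \<bar>u y\<bar>)"

text \<open>The measure \<open>\<rho>\<^bsup>-b\<^esup> d\<rho>\<close> on the positive half-line, as a measure on the whole real line.\<close>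

definition radial :: "real \<Rightarrow> real measure" where
  "radial b = density lebesgue (\<lambda>\<rho>. ennreal (\<rho> powr (- b)) * indicator {0<..} \<rho>)"

text \<open>The real-valued form of the ball-mass norm. Since \<open>h\<^sup>q\<close> is the power \<open>p q\<close> of the \<open>L\<^sup>p\<close> norm on the
  ball, it is an \<open>L\<^bsup>pq\<^esup>\<close> norm over the radii.\<close>

definition mass_norm :: "real \<Rightarrow> real \<Rightarrow> real \<Rightarrow> ('a::euclidean_space \<Rightarrow> real) \<Rightarrow> real" where
  "mass_norm p q b u = Lp_norm (radial b) (p * q) (ball_norm p u)"

text \<open>The functions for which \<open>mass_norm\<close> is meaningful; among measurable functions these are the ones of
  finite ball-mass norm, see \<open>mass_fun_iff\<close>.\<close>

definition mass_fun :: "real \<Rightarrow> real \<Rightarrow> real \<Rightarrow> ('a::euclidean_space \<Rightarrow> real) \<Rightarrow> bool" where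
  "mass_fun p q b u \<longleftrightarrow> u \<in> borel_measurable lebesgue \<and>
     (\<forall>\<rho>. Lp_fun (lebesgue_on (ball 0 \<rho>)) p (\<lambda>y. \<bar>u y\<bar>)) \<and>
     Lp_fun (radial b) (p * q) (ball_norm p u)"

lemma ball_norm_nonneg: "0 \<le> ball_norm p u \<rho>"
  by (simp add: ball_norm_def Lp_norm_nonneg)

lemma mass_norm_nonneg: "0 \<le> mass_norm p q b u"
  by (simp add: mass_norm_def Lp_norm_nonneg)

lemma measurable_radial: "borel_measurable (radial b) = borel_measurable lebesgue"
  unfolding radial_def by (intro measurable_cong_sets) auto

lemma space_radial [simp]: "space (radial b) = UNIV"
  by (simp add: radial_def)

lemma nn_integral_radial:
  assumes "f \<in> borel_measurable lebesgue"
  shows "(\<integral>\<^sup>+\<rho>. f \<rho> \<partial>radial b) = (\<integral>\<^sup>+\<rho>\<in>{0<..}. ennreal (\<rho> powr (- b)) * f \<rho> \<partial>lebesgue)"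
proof -
  have "(\<lambda>\<rho>::real. ennreal (\<rho> powr (- b)) * indicator {0<..} \<rho>) \<in> borel_measurable borel" by measurable
  then have "(\<lambda>\<rho>::real. ennreal (\<rho> powr (- b)) * indicator {0<..} \<rho>) \<in> borel_measurable lebesgue"
    by (intro measurable_completion) simp
  then show ?thesis
    unfolding radial_def using assms by (subst nn_integral_density) (simp_all add: mult_ac)
qed

lemma borel_measurable_lebesgue_mono:
  fixes f :: "real \<Rightarrow> real"
  assumes "mono f"
  shows "f \<in> borel_measurable lebesgue"
  using borel_measurable_mono[OF assms] by (intro measurable_completion) simp

lemma finite_measure_ball: "finite_measure (lebesgue_on (ball (0 :: 'a::euclidean_space) \<rho>))"
  by (intro finite_measure_lebesgue_on) auto

lemma Lp_restrict:
  assumes "s > 0" "Lp_fun lebesgue s f" "A \<in> sets lebesgue"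
  shows "Lp_fun (lebesgue_on A) s f" "Lp_norm (lebesgue_on A) s f \<le> Lp_norm lebesgue s f"
proof -
  have int: "integrable lebesgue (\<lambda>x. f x powr s)" and m: "f \<in> borel_measurable lebesgue"
    and nn: "\<And>x. 0 \<le> f x"
    using assms by (auto simp: Lp_fun_def)
  have intA: "integrable lebesgue (\<lambda>x. indicator A x *\<^sub>R f x powr s)"
    by (rule Bochner_Integration.integrable_bound[OF int])
       (use m assms(3) in \<open>auto intro!: borel_measurable_times borel_measurable_indicator simp: indicator_def\<close>)
  then show "Lp_fun (lebesgue_on A) s f"
    using m nn assms(3) by (auto simp: Lp_fun_def integrable_restrict_space intro: measurable_restrict_space1)
  have "(LINT x|lebesgue_on A. f x powr s) \<le> (LINT x|lebesgue. f x powr s)"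
    using assms(3) int intA
    by (subst integral_restrict_space) (auto intro!: integral_mono simp: indicator_def)
  then show "Lp_norm (lebesgue_on A) s f \<le> Lp_norm lebesgue s f"
    unfolding Lp_norm_def using assms by (intro powr_mono2) auto
qed

lemma ball_mass_eq:
  fixes u :: "'a::euclidean_space \<Rightarrow> real"
  shows "ball_mass p u \<rho> = (\<integral>\<^sup>+y. ennreal (\<bar>u y\<bar> powr p) \<partial>lebesgue_on (ball 0 \<rho>))"
  unfolding ball_mass_def by (subst nn_integral_restrict_space) auto

lemma Lp_fun_ball_iff:
  fixes u :: "'a::euclidean_space \<Rightarrow> real"
  assumes "u \<in> borel_measurable lebesgue"
  shows "Lp_fun (lebesgue_on (ball 0 \<rho>)) p (\<lambda>y. \<bar>u y\<bar>) \<longleftrightarrow> ball_mass p u \<rho> < \<infinity>"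
proof -
  have [measurable]: "u \<in> borel_measurable (lebesgue_on (ball 0 \<rho>))"
    using assms by (rule measurable_restrict_space1)
  show ?thesis by (simp add: Lp_fun_def integrable_iff_bounded ball_mass_eq)
qed

lemma ball_norm_eq:
  fixes u :: "'a::euclidean_space \<Rightarrow> real"
  assumes "u \<in> borel_measurable lebesgue"
  shows "ball_norm p u \<rho> = enn2real (ball_mass p u \<rho>) powr (1 / p)"
proof -
  have [measurable]: "u \<in> borel_measurable (lebesgue_on (ball 0 \<rho>))"
    using assms by (rule measurable_restrict_space1)
  show ?thesis
    unfolding ball_norm_def Lp_norm_def ball_mass_eq by (subst integral_eq_nn_integral) auto
qed

lemma ball_mass_mono: "\<rho> \<le> \<rho>' \<Longrightarrow> ball_mass p u \<rho> \<le> ball_mass p u \<rho>'"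
  unfolding ball_mass_def by (intro nn_integral_mono) (auto simp: indicator_def)

lemma mono_ball_norm:
  fixes u :: "'a::euclidean_space \<Rightarrow> real"
  assumes "p > 0" "u \<in> borel_measurable lebesgue" "\<And>\<rho>. Lp_fun (lebesgue_on (ball 0 \<rho>)) p (\<lambda>y. \<bar>u y\<bar>)"
  shows "mono (ball_norm p u)"
proof (rule monoI)
  fix \<rho> \<rho>' :: real assume "\<rho> \<le> \<rho>'"
  then have "enn2real (ball_mass p u \<rho>) \<le> enn2real (ball_mass p u \<rho>')"
    using assms(3)[of \<rho>'] by (intro enn2real_mono ball_mass_mono) (auto simp: Lp_fun_ball_iff assms(2))
  then show "ball_norm p u \<rho> \<le> ball_norm p u \<rho>'"
    using assms by (simp add: ball_norm_eq powr_mono2)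
qed

lemma borel_measurable_ball_norm:
  fixes u :: "'a::euclidean_space \<Rightarrow> real"
  assumes "p > 0" "u \<in> borel_measurable lebesgue" "\<And>\<rho>. Lp_fun (lebesgue_on (ball 0 \<rho>)) p (\<lambda>y. \<bar>u y\<bar>)"
  shows "ball_norm p u \<in> borel_measurable (radial b)"
  unfolding measurable_radial by (rule borel_measurable_lebesgue_mono[OF mono_ball_norm[OF assms]])

lemma mass_integral_eq:
  fixes u :: "'a::euclidean_space \<Rightarrow> real"
  assumes "p > 0" "u \<in> borel_measurable lebesgue" "\<And>\<rho>. Lp_fun (lebesgue_on (ball 0 \<rho>)) p (\<lambda>y. \<bar>u y\<bar>)"
  shows "(\<integral>\<^sup>+\<rho>\<in>{0<..}. ennreal (\<rho> powr (- b)) * ennpowr (ball_mass p u \<rho>) q \<partial>lebesgue)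
    = (\<integral>\<^sup>+\<rho>. ennreal (ball_norm p u \<rho> powr (p * q)) \<partial>radial b)"
proof -
  have "ennpowr (ball_mass p u \<rho>) q = ennreal (ball_norm p u \<rho> powr (p * q))" for \<rho>
    using assms(3)[of \<rho>] assms(1,2)
    by (auto simp: Lp_fun_ball_iff ennpowr_def ball_norm_eq powr_powr)
  moreover have "(\<lambda>\<rho>. ennreal (ball_norm p u \<rho> powr (p * q))) \<in> borel_measurable lebesgue"
    using borel_measurable_ball_norm[OF assms] unfolding measurable_radial by measurable
  ultimately show ?thesis by (simp add: nn_integral_radial)
qed

lemma L_norm_eq:
  fixes u :: "'a::euclidean_space \<Rightarrow> real"
  assumes "p > 0" "q > 0" "mass_fun p q b u"
  shows "L_norm p q b u = ennreal (mass_norm p q b u)"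
proof -
  have u: "u \<in> borel_measurable lebesgue" "\<And>\<rho>. Lp_fun (lebesgue_on (ball 0 \<rho>)) p (\<lambda>y. \<bar>u y\<bar>)"
    "Lp_fun (radial b) (p * q) (ball_norm p u)"
    using assms by (auto simp: mass_fun_def)
  have "(\<integral>\<^sup>+\<rho>. ennreal (ball_norm p u \<rho> powr (p * q)) \<partial>radial b)
      = ennreal (LINT \<rho>|radial b. ball_norm p u \<rho> powr (p * q))"
    using u(3) by (intro nn_integral_eq_integral) (auto simp: Lp_fun_def)
  then show ?thesis
    unfolding L_norm_def mass_integral_eq[OF assms(1) u(1,2)]
    by (simp add: ennpowr_def mass_norm_def Lp_norm_def)
qed

text \<open>An infinite ball mass at one radius is infinite at all larger radii and makes the norm infinite.\<close>

lemma ball_mass_finite: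
  fixes u :: "'a::euclidean_space \<Rightarrow> real"
  assumes "L_norm p q b u < \<infinity>"
  shows "ball_mass p u \<rho>0 < \<infinity>"
proof (rule ccontr)
  assume "\<not> ball_mass p u \<rho>0 < \<infinity>"
  then have inf: "ball_mass p u \<rho>0 = \<infinity>" by (simp add: not_less top_unique)
  define \<rho>1 where "\<rho>1 = max \<rho>0 0"
  let ?f = "\<lambda>\<rho>. ennreal (\<rho> powr (- b)) * ennpowr (ball_mass p u \<rho>) q * indicator {0<..} \<rho>"
  have "\<infinity> * emeasure lebesgue {\<rho>1<..<\<rho>1 + 1} = (\<integral>\<^sup>+\<rho>. \<infinity> * indicator {\<rho>1<..<\<rho>1 + 1} \<rho> \<partial>lebesgue)"
    by (rule nn_integral_cmult_indicator[symmetric]) simp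
  also have "\<dots> \<le> (\<integral>\<^sup>+\<rho>. ?f \<rho> \<partial>lebesgue)"
  proof (rule nn_integral_mono)
    fix \<rho> :: real
    show "\<infinity> * indicator {\<rho>1<..<\<rho>1 + 1} \<rho> \<le> ?f \<rho>"
    proof (cases "\<rho> \<in> {\<rho>1<..<\<rho>1 + 1}")
      case True
      then have \<rho>: "\<rho> > 0" "\<rho>0 \<le> \<rho>" by (auto simp: \<rho>1_def)
      have "ball_mass p u \<rho> = \<infinity>" using ball_mass_mono[OF \<rho>(2), of p u] inf by (simp add: top_unique)
      then show ?thesis using \<rho> by (simp add: ennpowr_def ennreal_mult_top)
    qed simp
  qed
  finally have "(\<integral>\<^sup>+\<rho>. ?f \<rho> \<partial>lebesgue) = \<infinity>" by (simp add: top_unique)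
  then have "L_norm p q b u = \<infinity>" by (simp add: L_norm_def ennpowr_def)
  then show False using assms by simp
qed

lemma mass_fun_iff:
  fixes u :: "'a::euclidean_space \<Rightarrow> real"
  assumes "p > 0" "q > 0" "u \<in> borel_measurable lebesgue"
  shows "mass_fun p q b u \<longleftrightarrow> L_norm p q b u < \<infinity>"
proof
  assume fin: "L_norm p q b u < \<infinity>"
  have Lp: "Lp_fun (lebesgue_on (ball 0 \<rho>)) p (\<lambda>y. \<bar>u y\<bar>)" for \<rho>
    using ball_mass_finite[OF fin] assms by (simp add: Lp_fun_ball_iff)
  note meas = borel_measurable_ball_norm[OF assms(1,3) Lp, of b]
  have "(\<integral>\<^sup>+\<rho>. ennreal (ball_norm p u \<rho> powr (p * q)) \<partial>radial b) < \<infinity>"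
    using fin unfolding L_norm_def mass_integral_eq[OF assms(1,3) Lp]
    by (auto simp: ennpowr_def less_top split: if_splits)
  then have "integrable (radial b) (\<lambda>\<rho>. ball_norm p u \<rho> powr (p * q))"
    using meas by (intro integrableI_nonneg) auto
  then show "mass_fun p q b u"
    using Lp meas assms by (auto simp: mass_fun_def Lp_fun_def ball_norm_nonneg)
qed (simp add: L_norm_eq[OF assms(1,2)])

text \<open>Restricting the radial integral to \<open>[\<rho>, 2 \<rho>]\<close> with \<open>\<rho> = max \<rho>0 1\<close> and using that the ball mass is nondecreasing
  shows that the ball-mass norm controls the \<open>L\<^sup>p\<close> norm on each ball.\<close>

lemma ball_norm_le_mass_norm:
  assumes "p > 0" "q > 0" "b > 0"
  obtains c where "c > 0" "\<And>u :: 'a::euclidean_space \<Rightarrow> real. mass_fun p q b u \<Longrightarrow> ball_norm p u \<rho>0 \<le> c * mass_norm p q b u"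
proof -
  define \<rho> where "\<rho> = max \<rho>0 1"
  have \<rho>: "\<rho> > 0" "\<rho>0 \<le> \<rho>" by (auto simp: \<rho>_def)
  let ?r = "p * q"
  define k where "k = (2 * \<rho>) powr (- b) * \<rho>"
  have k: "k > 0" using \<rho> by (simp add: k_def)
  have r: "?r > 0" using assms by simp
  show thesis
  proof
    show "(1 / k) powr (1 / ?r) > 0" using k by simp
    fix u :: "'a \<Rightarrow> real" assume u: "mass_fun p q b u"
    then have u': "u \<in> borel_measurable lebesgue" "\<And>\<rho>. Lp_fun (lebesgue_on (ball 0 \<rho>)) p (\<lambda>y. \<bar>u y\<bar>)"
      "Lp_fun (radial b) ?r (ball_norm p u)"
      by (auto simp: mass_fun_def)
    let ?B = "ball_norm p u"
    have meas: "(\<lambda>\<rho>. ennreal (?B \<rho> powr ?r)) \<in> borel_measurable lebesgue"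
      using borel_measurable_ball_norm[OF assms(1) u'(1,2)] unfolding measurable_radial by measurable
    have "ennreal (k * ?B \<rho> powr ?r) = ennreal ((2 * \<rho>) powr (- b) * ?B \<rho> powr ?r) * emeasure lebesgue {\<rho>..2 * \<rho>}"
      using \<rho> by (simp add: k_def mult_ac flip: ennreal_mult)
    also have "\<dots> = (\<integral>\<^sup>+s. ennreal ((2 * \<rho>) powr (- b) * ?B \<rho> powr ?r) * indicator {\<rho>..2 * \<rho>} s \<partial>lebesgue)"
      by (rule nn_integral_cmult_indicator[symmetric]) simp
    also have "\<dots> \<le> (\<integral>\<^sup>+s\<in>{0<..}. ennreal (s powr (- b)) * ennreal (?B s powr ?r) \<partial>lebesgue)"
    proof (rule nn_integral_mono)
      fix s :: real
      show "ennreal ((2 * \<rho>) powr (- b) * ?B \<rho> powr ?r) * indicator {\<rho>..2 * \<rho>} s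
        \<le> ennreal (s powr (- b)) * ennreal (?B s powr ?r) * indicator {0<..} s"
      proof (cases "s \<in> {\<rho>..2 * \<rho>}")
        case True
        have "?B \<rho> \<le> ?B s"
          using mono_ball_norm[OF assms(1) u'(1,2)] True by (auto dest: monoD)
        then have "(2 * \<rho>) powr (- b) * ?B \<rho> powr ?r \<le> s powr (- b) * ?B s powr ?r"
          using True assms \<rho> r by (intro mult_mono powr_mono2 powr_mono2') (auto simp: ball_norm_nonneg)
        then show ?thesis using True \<rho> by (simp flip: ennreal_mult add: ennreal_leI)
      qed simp
    qed
    also have "\<dots> = (\<integral>\<^sup>+s. ennreal (?B s powr ?r) \<partial>radial b)"
      using meas by (rule nn_integral_radial[symmetric])
    also have "\<dots> = ennreal (LINT s|radial b. ?B s powr ?r)"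
      using u'(3) by (intro nn_integral_eq_integral) (auto simp: Lp_fun_def)
    also have "\<dots> = ennreal (mass_norm p q b u powr ?r)"
      using r by (simp add: mass_norm_def Lp_norm_powr)
    finally have "k * ?B \<rho> powr ?r \<le> mass_norm p q b u powr ?r" by simp
    then have "?B \<rho> powr ?r \<le> 1 / k * mass_norm p q b u powr ?r"
      using k by (simp add: field_simps)
    then have "(?B \<rho> powr ?r) powr (1 / ?r) \<le> (1 / k * mass_norm p q b u powr ?r) powr (1 / ?r)"
      using r by (intro powr_mono2) auto
    also have "\<dots> = (1 / k) powr (1 / ?r) * (mass_norm p q b u powr ?r) powr (1 / ?r)"
      by (rule powr_mult)
    finally have "?B \<rho> \<le> (1 / k) powr (1 / ?r) * mass_norm p q b u"
      using assms by (simp add: powr_powr ball_norm_nonneg mass_norm_nonneg)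
    moreover have "?B \<rho>0 \<le> ?B \<rho>" by (rule monoD[OF mono_ball_norm[OF assms(1) u'(1,2)] \<rho>(2)])
    ultimately show "?B \<rho>0 \<le> (1 / k) powr (1 / ?r) * mass_norm p q b u" by simp
  qed
qed

section \<open>Local convergence from bounds on balls\<close>

lemma AE_lebesgue_of_balls:
  assumes "\<And>n::nat. AE x in lebesgue_on (ball (0 :: 'a::euclidean_space) (real n)). P x"
  shows "AE x in lebesgue. P x"
proof -
  have "AE x in lebesgue. \<forall>n::nat. x \<in> ball (0 :: 'a) (real n) \<longrightarrow> P x"
    unfolding AE_all_countable using assms by (subst (asm) AE_restrict_space_iff) auto
  then show ?thesis
  proof eventually_elim
    case (elim x)
    obtain n where "norm x < real n" using reals_Archimedean2 by blast
    then show ?case using elim by auto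
  qed
qed

lemma convergent_if_summable_increments:
  fixes f :: "nat \<Rightarrow> 'b::banach"
  assumes "summable (\<lambda>k. norm (f (Suc k) - f k))"
  shows "convergent f"
proof -
  have "convergent (\<lambda>n. \<Sum>k<n. f (Suc k) - f k)"
    using summable_norm_cancel[OF assms] by (simp add: summable_iff_convergent)
  then have "convergent (\<lambda>n. f n - f 0)" by (simp add: sum_lessThan_telescope)
  then show ?thesis by (simp add: convergent_diff_const_right_iff)
qed

lemma locally_integrable_of_Lp:
  fixes f :: "'a::euclidean_space \<Rightarrow> 'b::euclidean_space"
  assumes "s \<ge> 1" "f \<in> borel_measurable lebesgue"
    "\<And>\<rho>. Lp_fun (lebesgue_on (ball 0 \<rho>)) s (\<lambda>x. norm (f x))"
  shows "locally_integrable f"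
  unfolding locally_integrable_def
proof (intro allI impI)
  fix K :: "'a set" assume K: "compact K"
  then obtain \<rho> where "K \<subseteq> ball 0 \<rho>"
    using bounded_subset_ballD[OF compact_imp_bounded] by metis
  have "integrable (lebesgue_on (ball 0 \<rho>)) (\<lambda>x. norm (f x))"
    by (rule integral_le_Lp_norm(1)[OF assms(1) finite_measure_ball assms(3)])
  then have "integrable (lebesgue_on (ball 0 \<rho>)) f"
    using assms(2) by (subst (asm) integrable_norm_iff) (auto intro: measurable_restrict_space1)
  then have "f absolutely_integrable_on ball 0 \<rho>"
    by (simp add: integrable_restrict_space set_integrable_def)
  then show "f absolutely_integrable_on K"
    using \<open>K \<subseteq> ball 0 \<rho>\<close> K by (rule_tac set_integrable_subset) (auto simp: compact_imp_closed borel_closed)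
qed

lemma local_L1_tendsto:
  fixes f :: "nat \<Rightarrow> 'a::euclidean_space \<Rightarrow> 'b::euclidean_space"
  assumes "s \<ge> 1" "compact K" "\<And>k. f k \<in> borel_measurable lebesgue"
    "\<And>k \<rho>. Lp_fun (lebesgue_on (ball 0 \<rho>)) s (\<lambda>x. norm (f k x))"
    "\<And>\<rho>. (\<lambda>k. Lp_norm (lebesgue_on (ball 0 \<rho>)) s (\<lambda>x. norm (f k x))) \<longlonglongrightarrow> 0"
  shows "(\<lambda>k. LINT x|lebesgue. indicator K x * norm (f k x)) \<longlonglongrightarrow> 0"
proof -
  obtain \<rho> where \<rho>: "K \<subseteq> ball 0 \<rho>"
    using bounded_subset_ballD[OF compact_imp_bounded[OF assms(2)]] by metis
  let ?M = "lebesgue_on (ball (0 :: 'a) \<rho>)"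
  let ?C = "measure ?M (space ?M) + 1"
  show ?thesis
  proof (rule Lim_null_comparison)
    show "(\<lambda>k. ?C * Lp_norm ?M s (\<lambda>x. norm (f k x))) \<longlonglongrightarrow> 0"
      using tendsto_mult_left[OF assms(5), of ?C] by simp
    show "eventually (\<lambda>k. norm (LINT x|lebesgue. indicator K x * norm (f k x))
        \<le> ?C * Lp_norm ?M s (\<lambda>x. norm (f k x))) sequentially"
    proof (intro always_eventually allI)
      fix k
      note I = integral_le_Lp_norm[OF assms(1) finite_measure_ball assms(4)]
      have "(LINT x|lebesgue. indicator K x * norm (f k x)) \<le> (LINT x|lebesgue. indicator (ball 0 \<rho>) x *\<^sub>R norm (f k x))"
      proof (rule integral_mono)
        show "integrable lebesgue (\<lambda>x. indicator K x * norm (f k x))"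
          by (rule locally_integrable_norm[OF locally_integrable_of_Lp[OF assms(1,3,4)] assms(2)])
        show "integrable lebesgue (\<lambda>x. indicator (ball 0 \<rho>) x *\<^sub>R norm (f k x))"
          using I(1)[of \<rho> k] by (simp add: integrable_restrict_space)
      qed (use \<rho> in \<open>auto simp: indicator_def\<close>)
      also have "\<dots> = (LINT x|?M. norm (f k x))" by (simp add: integral_restrict_space)
      also have "\<dots> \<le> ?C * Lp_norm ?M s (\<lambda>x. norm (f k x))" by (rule I(2))
      finally show "norm (LINT x|lebesgue. indicator K x * norm (f k x)) \<le> ?C * Lp_norm ?M s (\<lambda>x. norm (f k x))"
        by (simp add: integral_nonneg_AE)
    qed
  qed
qed

text \<open>Geometric decay of the increments in \<open>L\<^sup>s\<close> on balls yields almost everywhere convergence.\<close>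

lemma fast_subsequence_converges:
  fixes f :: "nat \<Rightarrow> 'a::euclidean_space \<Rightarrow> 'b::euclidean_space"
  assumes "s \<ge> 1"
    "\<And>k n. Lp_fun (lebesgue_on (ball 0 (real n))) s (\<lambda>x. norm (f (Suc k) x - f k x))"
    "\<And>k n. Lp_norm (lebesgue_on (ball 0 (real n))) s (\<lambda>x. norm (f (Suc k) x - f k x)) \<le> C n * (1 / 2) ^ k"
  shows "AE x in lebesgue. (\<lambda>k. f k x) \<longlonglongrightarrow> lim (\<lambda>k. f k x)"
proof -
  have "AE x in lebesgue. summable (\<lambda>k. norm (f (Suc k) x - f k x))"
  proof (rule AE_lebesgue_of_balls)
    fix n :: nat
    have "summable (\<lambda>k. Lp_norm (lebesgue_on (ball 0 (real n))) s (\<lambda>x. norm (f (Suc k) x - f k x)))"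
    proof (rule summable_comparison_test')
      show "summable (\<lambda>k. C n * (1 / 2) ^ k)" by (intro summable_mult summable_geometric) simp
      show "norm (Lp_norm (lebesgue_on (ball 0 (real n))) s (\<lambda>x. norm (f (Suc k) x - f k x))) \<le> C n * (1 / 2) ^ k" for k
        using assms(3)[of n k] by (simp add: Lp_norm_nonneg)
    qed
    then show "AE x in lebesgue_on (ball 0 (real n)). summable (\<lambda>k. norm (f (Suc k) x - f k x))"
      by (intro AE_summable_of_Lp_norm[OF assms(1) finite_measure_ball assms(2)])
  qed
  then show ?thesis
    by eventually_elim (intro convergent_LIMSEQ_iff[THEN iffD1] convergent_if_summable_increments)
qed

section \<open>Representatives with their weak gradients\<close>

text \<open>A function of the space together with one of its weak gradients. Carrying the gradient explicitly
  makes sums and multiples of representatives available without reference to the choice made in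
  \<open>weak_gradient\<close>.\<close>

definition E_rep :: "real \<Rightarrow> real \<Rightarrow> real \<Rightarrow> ('a::euclidean_space \<Rightarrow> real) \<Rightarrow> ('a \<Rightarrow> 'a) \<Rightarrow> bool" where
  "E_rep p q b u G \<longleftrightarrow>
     has_weak_gradient u G \<and> Lp_fun lebesgue 2 (\<lambda>x. norm (G x)) \<and> mass_fun p q b u"

text \<open>The \<open>\<ell>\<^sup>s\<close> norm of a pair, written as an \<open>L\<^sup>s\<close> norm over a two-point space so that the general results
  on \<open>L\<^sup>s\<close> norms apply.\<close>

definition pair_norm :: "real \<Rightarrow> real \<Rightarrow> real \<Rightarrow> real" where
  "pair_norm s x y = Lp_norm (count_space UNIV) s (\<lambda>i::bool. if i then x else y)"

definition rep_norm :: "real \<Rightarrow> real \<Rightarrow> real \<Rightarrow> ('a::euclidean_space \<Rightarrow> real) \<Rightarrow> ('a \<Rightarrow> 'a) \<Rightarrow> real" where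
  "rep_norm p q b u G = pair_norm (2 * p * q) (Lp_norm lebesgue 2 (\<lambda>x. norm (G x))) (mass_norm p q b u)"

lemma Lp_fun_pair: "0 \<le> x \<Longrightarrow> 0 \<le> y \<Longrightarrow> Lp_fun (count_space UNIV) s (\<lambda>i::bool. if i then x else y)"
  by (auto simp: Lp_fun_def intro!: integrable_count_space)

lemma pair_norm_eq: "pair_norm s x y = (x powr s + y powr s) powr (1 / s)"
  by (simp add: pair_norm_def Lp_norm_def lebesgue_integral_count_space_finite UNIV_bool add.commute)

lemma pair_norm_nonneg: "0 \<le> pair_norm s x y"
  by (simp add: pair_norm_eq)

lemma pair_norm_ge:
  assumes "s > 0" "0 \<le> x" "0 \<le> y"
  shows "x \<le> pair_norm s x y" "y \<le> pair_norm s x y"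
proof -
  have "(x powr s) powr (1 / s) \<le> pair_norm s x y" "(y powr s) powr (1 / s) \<le> pair_norm s x y"
    unfolding pair_norm_eq using assms by (auto intro!: powr_mono2)
  then show "x \<le> pair_norm s x y" "y \<le> pair_norm s x y" using assms by (auto simp: powr_powr)
qed

lemma pair_norm_0 [simp]: "pair_norm s 0 0 = 0"
  by (simp add: pair_norm_eq)

lemma pair_norm_triangle:
  assumes "s \<ge> 1" "0 \<le> x" "0 \<le> y" "0 \<le> x1" "0 \<le> y1" "0 \<le> x2" "0 \<le> y2" "x \<le> x1 + x2" "y \<le> y1 + y2"
  shows "pair_norm s x y \<le> pair_norm s x1 y1 + pair_norm s x2 y2"
  unfolding pair_norm_def
  by (rule Lp_triangle(2)) (use assms Lp_fun_pair in auto)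

lemma pair_norm_le_add:
  assumes "s \<ge> 1" "0 \<le> x" "0 \<le> y"
  shows "pair_norm s x y \<le> x + y"
  using pair_norm_triangle[of s x y x 0 0 y] assms by (simp add: pair_norm_eq powr_powr)

lemma pair_norm_scale:
  assumes "s > 0" "0 \<le> c" "0 \<le> x" "0 \<le> y"
  shows "pair_norm s (c * x) (c * y) = c * pair_norm s x y"
proof -
  have "pair_norm s (c * x) (c * y) = Lp_norm (count_space UNIV) s (\<lambda>i::bool. c * (if i then x else y))"
    unfolding pair_norm_def by (rule arg_cong[where f = "Lp_norm _ s"]) auto
  then show ?thesis using Lp_scale(2)[OF assms(1,2) Lp_fun_pair[OF assms(3,4)]] by (simp add: pair_norm_def)
qed

text \<open>Any weak gradient computes the gradient norm, by uniqueness.\<close>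

lemma grad_norm_eq_Lp_norm:
  fixes G :: "'a::euclidean_space \<Rightarrow> 'a"
  assumes "has_weak_gradient u G"
  shows "Lp_fun lebesgue 2 (\<lambda>x. norm (G x)) \<longleftrightarrow> grad_norm u < \<infinity>"
    "enn2real (grad_norm u) = Lp_norm lebesgue 2 (\<lambda>x. norm (G x))"
proof -
  have m[measurable]: "G \<in> borel_measurable lebesgue"
    using assms by (auto simp: has_weak_gradient_def intro: locally_integrable_measurable)
  have W: "has_weak_gradient u (weak_gradient u)"
    using assms by (intro has_weak_gradient_weak_gradient) (auto simp: weakly_differentiable_def)
  have "(\<integral>\<^sup>+x. ennreal ((norm (weak_gradient u x))\<^sup>2) \<partial>lebesgue) = (\<integral>\<^sup>+x. ennreal (norm (G x) powr 2) \<partial>lebesgue)"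
    using weak_gradient_unique[OF W assms] by (intro nn_integral_cong_AE) (auto elim!: eventually_mono)
  then have eq: "grad_norm u = ennpowr (\<integral>\<^sup>+x. ennreal (norm (G x) powr 2) \<partial>lebesgue) (1 / 2)"
    by (simp only: grad_norm_def)
  show "Lp_fun lebesgue 2 (\<lambda>x. norm (G x)) \<longleftrightarrow> grad_norm u < \<infinity>"
    unfolding eq ennpowr_def by (auto simp: Lp_fun_def integrable_iff_bounded less_top)
  have "Lp_norm lebesgue 2 (\<lambda>x. norm (G x)) = enn2real (\<integral>\<^sup>+x. ennreal (norm (G x) powr 2) \<partial>lebesgue) powr (1 / 2)"
    unfolding Lp_norm_def by (subst integral_eq_nn_integral) auto
  then show "enn2real (grad_norm u) = Lp_norm lebesgue 2 (\<lambda>x. norm (G x))"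
    unfolding eq ennpowr_def by auto
qed

section \<open>Classes of functions that agree almost everywhere\<close>

lemma ae_eq_iff: "(u, v) \<in> ae_eq \<longleftrightarrow> (AE x in lebesgue. u x = v x)"
  by (simp add: ae_eq_def)

lemma equiv_ae_eq: "equiv UNIV (ae_eq :: (('a::euclidean_space \<Rightarrow> real) \<times> ('a \<Rightarrow> real)) set)"
proof (rule equivI)
  show "sym (ae_eq :: (('a \<Rightarrow> real) \<times> ('a \<Rightarrow> real)) set)" by (auto simp: sym_def ae_eq_def elim: eventually_mono)
  show "trans (ae_eq :: (('a \<Rightarrow> real) \<times> ('a \<Rightarrow> real)) set)"
  proof (rule transI)
    fix u v w :: "'a \<Rightarrow> real" assume "(u, v) \<in> ae_eq" "(v, w) \<in> ae_eq"
    then have "AE x in lebesgue. u x = v x" "AE x in lebesgue. v x = w x" by (simp_all add: ae_eq_def)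
    then have "AE x in lebesgue. u x = w x" by eventually_elim simp
    then show "(u, w) \<in> ae_eq" by (simp add: ae_eq_def)
  qed
qed (auto simp: refl_on_def ae_eq_def)

lemma ae_class_eq_iff: "ae_eq `` {u} = ae_eq `` {v} \<longleftrightarrow> (AE x in lebesgue. u x = v x)"
  using eq_equiv_class_iff[OF equiv_ae_eq, of u v] by (simp add: ae_eq_def)

lemma ae_add_class: "ae_add (ae_eq `` {u}) (ae_eq `` {v}) = ae_eq `` {\<lambda>x. u x + v x}"
proof -
  have "ae_eq `` {\<lambda>x. u' x + v' x} = ae_eq `` {\<lambda>x. u x + v x}"
    if "u' \<in> ae_eq `` {u}" "v' \<in> ae_eq `` {v}" for u' v'
  proof -
    have "AE x in lebesgue. u x = u' x" "AE x in lebesgue. v x = v' x" using that by (simp_all add: ae_eq_iff)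
    then have "AE x in lebesgue. u' x + v' x = u x + v x" by eventually_elim simp
    then show ?thesis by (simp add: ae_class_eq_iff)
  qed
  moreover have "u \<in> ae_eq `` {u}" "v \<in> ae_eq `` {v}" by (simp_all add: ae_eq_iff)
  ultimately show ?thesis unfolding ae_add_def by blast
qed

lemma ae_scale_class: "ae_scale c (ae_eq `` {u}) = ae_eq `` {\<lambda>x. c * u x}"
proof -
  have "ae_eq `` {\<lambda>x. c * u' x} = ae_eq `` {\<lambda>x. c * u x}" if "u' \<in> ae_eq `` {u}" for u'
  proof -
    have "AE x in lebesgue. u x = u' x" using that by (simp add: ae_eq_iff)
    then have "AE x in lebesgue. c * u' x = c * u x" by eventually_elim simp
    then show ?thesis by (simp add: ae_class_eq_iff)
  qed
  moreover have "u \<in> ae_eq `` {u}" by (simp add: ae_eq_iff)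
  ultimately show ?thesis unfolding ae_scale_def by blast
qed

context
  fixes p q b :: real
  assumes p: "1 < p" and q: "1 \<le> q" and b: "0 < b"
begin

lemma exponents: "p > 0" "q > 0" "p \<ge> 1" "p * q > 0" "p * q > 1" "p * q \<ge> 1"
  "2 * p * q > 1" "2 * p * q \<ge> 1" "2 * p * q > 0"
proof -
  have "1 * 1 < p * q" using p q by (intro mult_less_le_imp_less) auto
  then show "p > 0" "q > 0" "p \<ge> 1" "p * q > 0" "p * q > 1" "p * q \<ge> 1"
    "2 * p * q > 1" "2 * p * q \<ge> 1" "2 * p * q > 0" using p q by auto
qed

lemma E_rep_E_fun:
  assumes "E_rep p q b u G"
  shows "u \<in> E_fun p q b" "E_fun_norm p q b u = rep_norm p q b u G"
proof -
  have G: "has_weak_gradient u G" "Lp_fun lebesgue 2 (\<lambda>x. norm (G x))" and u: "mass_fun p q b u"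
    using assms by (auto simp: E_rep_def)
  note L = L_norm_eq[OF exponents(1,2) u]
  show "u \<in> E_fun p q b"
    using G grad_norm_eq_Lp_norm(1)[OF G(1)] by (auto simp: E_fun_def weakly_differentiable_def L)
  show "E_fun_norm p q b u = rep_norm p q b u G"
    unfolding E_fun_norm_def L grad_norm_eq_Lp_norm(2)[OF G(1)]
    by (simp add: rep_norm_def pair_norm_eq mass_norm_def Lp_norm_nonneg)
qed

lemma E_fun_E_rep:
  assumes "u \<in> E_fun p q b"
  shows "E_rep p q b u (weak_gradient u)"
proof -
  have G: "has_weak_gradient u (weak_gradient u)"
    using assms by (auto simp: E_fun_def intro: has_weak_gradient_weak_gradient)
  then have "u \<in> borel_measurable lebesgue"
    by (auto simp: has_weak_gradient_def intro: locally_integrable_measurable)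
  moreover have "grad_norm u < \<infinity>" "L_norm p q b u < \<infinity>" using assms by (auto simp: E_fun_def less_top)
  ultimately show ?thesis
    unfolding E_rep_def using G mass_fun_iff[OF exponents(1,2)] grad_norm_eq_Lp_norm(1)[OF G] by blast
qed

lemma mass_fun_subadditive:
  fixes u v w :: "'a::euclidean_space \<Rightarrow> real"
  assumes "mass_fun p q b u" "mass_fun p q b v" "w \<in> borel_measurable lebesgue"
    "\<And>x. \<bar>w x\<bar> \<le> \<bar>u x\<bar> + \<bar>v x\<bar>"
  shows "mass_fun p q b w" "ball_norm p w \<rho> \<le> ball_norm p u \<rho> + ball_norm p v \<rho>"
    "mass_norm p q b w \<le> mass_norm p q b u + mass_norm p q b v"
proof -
  have u: "\<And>\<rho>. Lp_fun (lebesgue_on (ball 0 \<rho>)) p (\<lambda>y. \<bar>u y\<bar>)" "Lp_fun (radial b) (p * q) (ball_norm p u)"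
    and v: "\<And>\<rho>. Lp_fun (lebesgue_on (ball 0 \<rho>)) p (\<lambda>y. \<bar>v y\<bar>)" "Lp_fun (radial b) (p * q) (ball_norm p v)"
    using assms by (auto simp: mass_fun_def)
  have mw: "(\<lambda>x. \<bar>w x\<bar>) \<in> borel_measurable (lebesgue_on (ball 0 \<rho>))" for \<rho>
    using assms(3) by (intro borel_measurable_abs measurable_restrict_space1)
  have w: "Lp_fun (lebesgue_on (ball 0 \<rho>)) p (\<lambda>y. \<bar>w y\<bar>)" for \<rho>
    by (rule Lp_triangle(1)[OF exponents(3) u(1) v(1) mw]) (use assms(4) in auto)
  have le: "ball_norm p w \<rho> \<le> ball_norm p u \<rho> + ball_norm p v \<rho>" for \<rho>
    unfolding ball_norm_def
    by (rule Lp_triangle(2)[OF exponents(3) u(1) v(1) mw]) (use assms(4) in auto)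
  then show "ball_norm p w \<rho> \<le> ball_norm p u \<rho> + ball_norm p v \<rho>" .
  note mb = borel_measurable_ball_norm[OF exponents(1) assms(3) w, of b]
  show "mass_fun p q b w"
    unfolding mass_fun_def
    using assms(3) w Lp_triangle(1)[OF exponents(6) u(2) v(2) mb ball_norm_nonneg le] by blast
  show "mass_norm p q b w \<le> mass_norm p q b u + mass_norm p q b v"
    unfolding mass_norm_def by (rule Lp_triangle(2)[OF exponents(6) u(2) v(2) mb ball_norm_nonneg le])
qed

lemma mass_fun_scale:
  fixes u :: "'a::euclidean_space \<Rightarrow> real"
  assumes "mass_fun p q b u"
  shows "mass_fun p q b (\<lambda>x. c * u x)" "mass_norm p q b (\<lambda>x. c * u x) = \<bar>c\<bar> * mass_norm p q b u"
proof -
  have u: "u \<in> borel_measurable lebesgue" "\<And>\<rho>. Lp_fun (lebesgue_on (ball 0 \<rho>)) p (\<lambda>y. \<bar>u y\<bar>)"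
    "Lp_fun (radial b) (p * q) (ball_norm p u)"
    using assms by (auto simp: mass_fun_def)
  note sc = Lp_scale[OF exponents(1) abs_ge_zero[of c] u(2)]
  have B: "ball_norm p (\<lambda>x. c * u x) = (\<lambda>\<rho>. \<bar>c\<bar> * ball_norm p u \<rho>)"
    using sc(2) by (simp add: ball_norm_def abs_mult fun_eq_iff)
  note sc2 = Lp_scale[OF exponents(4) abs_ge_zero[of c] u(3)]
  show "mass_fun p q b (\<lambda>x. c * u x)"
    using u(1) sc(1) sc2(1) by (auto simp: mass_fun_def B abs_mult)
  show "mass_norm p q b (\<lambda>x. c * u x) = \<bar>c\<bar> * mass_norm p q b u"
    using sc2(2) by (simp add: mass_norm_def B)
qed

lemma mass_fun_cong_AE:
  fixes u v :: "'a::euclidean_space \<Rightarrow> real"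
  assumes "mass_fun p q b u" "AE x in lebesgue. u x = v x"
  shows "mass_fun p q b v" "mass_norm p q b v = mass_norm p q b u"
proof -
  have u: "u \<in> borel_measurable lebesgue" "\<And>\<rho>. Lp_fun (lebesgue_on (ball 0 \<rho>)) p (\<lambda>y. \<bar>u y\<bar>)"
    "Lp_fun (radial b) (p * q) (ball_norm p u)"
    using assms by (auto simp: mass_fun_def)
  have mv: "v \<in> borel_measurable lebesgue" by (rule borel_measurable_AE[OF u(1) assms(2)])
  have mv': "(\<lambda>x. \<bar>v x\<bar>) \<in> borel_measurable (lebesgue_on (ball 0 \<rho>))" for \<rho>
    using mv by (intro borel_measurable_abs measurable_restrict_space1)
  have ae: "AE x in lebesgue_on (ball 0 \<rho>). \<bar>v x\<bar> = \<bar>u x\<bar>" for \<rho>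
    using assms(2) by (subst AE_restrict_space_iff) (auto elim!: eventually_mono)
  note c = Lp_cong_AE[OF u(2) mv' _ ae]
  have B: "ball_norm p v = ball_norm p u"
    unfolding ball_norm_def fun_eq_iff by (intro allI c(2)) auto
  show "mass_fun p q b v" "mass_norm p q b v = mass_norm p q b u"
    using mv c(1) u(3) by (auto simp: mass_fun_def mass_norm_def B)
qed

lemma E_rep_measurable:
  fixes u :: "'a::euclidean_space \<Rightarrow> real"
  assumes "E_rep p q b u G"
  shows "u \<in> borel_measurable lebesgue" "G \<in> borel_measurable lebesgue"
  using assms by (auto simp: E_rep_def has_weak_gradient_def intro: locally_integrable_measurable)

lemma rep_norm_nonneg: "0 \<le> rep_norm p q b u G"
  by (simp add: rep_norm_def pair_norm_nonneg)

lemma rep_norm_ge: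
  "Lp_norm lebesgue 2 (\<lambda>x. norm (G x)) \<le> rep_norm p q b u G" "mass_norm p q b u \<le> rep_norm p q b u G"
  unfolding rep_norm_def mass_norm_def
  by (intro pair_norm_ge exponents Lp_norm_nonneg)+

lemma E_rep_scale:
  fixes u :: "'a::euclidean_space \<Rightarrow> real"
  assumes "E_rep p q b u G"
  shows "E_rep p q b (\<lambda>x. c * u x) (\<lambda>x. c *\<^sub>R G x)"
    "rep_norm p q b (\<lambda>x. c * u x) (\<lambda>x. c *\<^sub>R G x) = \<bar>c\<bar> * rep_norm p q b u G"
proof -
  have G: "has_weak_gradient u G" "Lp_fun lebesgue 2 (\<lambda>x. norm (G x))" and u: "mass_fun p q b u"
    using assms by (auto simp: E_rep_def)
  have sc: "Lp_fun lebesgue 2 (\<lambda>x. norm (c *\<^sub>R G x))"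
    "Lp_norm lebesgue 2 (\<lambda>x. norm (c *\<^sub>R G x)) = \<bar>c\<bar> * Lp_norm lebesgue 2 (\<lambda>x. norm (G x))"
    using Lp_scale[OF _ abs_ge_zero G(2), of c] by auto
  show "E_rep p q b (\<lambda>x. c * u x) (\<lambda>x. c *\<^sub>R G x)"
    using has_weak_gradient_lincomb[OF G(1) G(1), where a = c and b = 0] sc(1) mass_fun_scale(1)[OF u]
    by (simp add: E_rep_def)
  show "rep_norm p q b (\<lambda>x. c * u x) (\<lambda>x. c *\<^sub>R G x) = \<bar>c\<bar> * rep_norm p q b u G"
    unfolding rep_norm_def sc(2) mass_fun_scale(2)[OF u]
    by (intro pair_norm_scale exponents abs_ge_zero Lp_norm_nonneg mass_norm_nonneg)
qed

lemma E_rep_add: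
  fixes u v :: "'a::euclidean_space \<Rightarrow> real"
  assumes "E_rep p q b u G" "E_rep p q b v H"
  shows "E_rep p q b (\<lambda>x. u x + v x) (\<lambda>x. G x + H x)"
    "rep_norm p q b (\<lambda>x. u x + v x) (\<lambda>x. G x + H x) \<le> rep_norm p q b u G + rep_norm p q b v H"
proof -
  have G: "has_weak_gradient u G" "Lp_fun lebesgue 2 (\<lambda>x. norm (G x))" and u: "mass_fun p q b u"
    and H: "has_weak_gradient v H" "Lp_fun lebesgue 2 (\<lambda>x. norm (H x))" and v: "mass_fun p q b v"
    using assms by (auto simp: E_rep_def)
  have [measurable]: "u \<in> borel_measurable lebesgue" "v \<in> borel_measurable lebesgue"
    "G \<in> borel_measurable lebesgue" "H \<in> borel_measurable lebesgue"
    using E_rep_measurable assms by auto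
  have muv: "(\<lambda>x. u x + v x) \<in> borel_measurable lebesgue" by measurable
  have mGH: "(\<lambda>x. norm (G x + H x)) \<in> borel_measurable lebesgue" by measurable
  note tri = Lp_triangle[OF _ G(2) H(2) mGH norm_ge_zero norm_triangle_ineq]
  note sub = mass_fun_subadditive[OF u v muv abs_triangle_ineq]
  show "E_rep p q b (\<lambda>x. u x + v x) (\<lambda>x. G x + H x)"
    using has_weak_gradient_lincomb[OF G(1) H(1), where a = 1 and b = 1] tri(1) sub(1)
    by (simp add: E_rep_def)
  show "rep_norm p q b (\<lambda>x. u x + v x) (\<lambda>x. G x + H x) \<le> rep_norm p q b u G + rep_norm p q b v H"
    unfolding rep_norm_def
    by (rule pair_norm_triangle)
       (use exponents tri(2) sub(3) in \<open>auto simp: Lp_norm_nonneg mass_norm_def\<close>)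
qed

lemma E_rep_diff:
  fixes u v :: "'a::euclidean_space \<Rightarrow> real"
  assumes "E_rep p q b u G" "E_rep p q b v H"
  shows "E_rep p q b (\<lambda>x. u x - v x) (\<lambda>x. G x - H x)"
  using E_rep_add(1)[OF assms(1) E_rep_scale(1)[OF assms(2), of "-1"]] by simp

lemma E_rep_cong_AE:
  fixes u v :: "'a::euclidean_space \<Rightarrow> real"
  assumes "E_rep p q b u G" "AE x in lebesgue. u x = v x"
  shows "E_rep p q b v G" "rep_norm p q b v G = rep_norm p q b u G"
  using assms has_weak_gradient_cong_AE[of u G v] mass_fun_cong_AE[of u v]
  by (auto simp: E_rep_def rep_norm_def)

lemma E_rep_zero: "E_rep p q b (\<lambda>x::'a::euclidean_space. 0) (\<lambda>x. 0)" "rep_norm p q b (\<lambda>x::'a. 0) (\<lambda>x. 0) = 0"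
proof -
  have B: "ball_norm p (\<lambda>x::'a. 0) = (\<lambda>\<rho>. 0)" by (simp add: ball_norm_def Lp_norm_def fun_eq_iff)
  have "has_weak_gradient (\<lambda>x::'a. 0) (\<lambda>x. 0)"
    by (simp add: has_weak_gradient_def locally_integrable_def set_integrable_def)
  then show "E_rep p q b (\<lambda>x::'a. 0) (\<lambda>x. 0)"
    by (simp add: E_rep_def mass_fun_def B Lp_fun_def)
  show "rep_norm p q b (\<lambda>x::'a. 0) (\<lambda>x. 0) = 0"
    by (simp add: rep_norm_def mass_norm_def B Lp_norm_def)
qed

lemma rep_norm_eq_0_imp:
  fixes u :: "'a::euclidean_space \<Rightarrow> real"
  assumes "E_rep p q b u G" "rep_norm p q b u G = 0"
  shows "AE x in lebesgue. u x = 0"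
proof (rule AE_lebesgue_of_balls)
  fix n :: nat
  have u: "mass_fun p q b u" using assms by (auto simp: E_rep_def)
  have m0: "mass_norm p q b u \<le> 0" using rep_norm_ge(2)[of u G] assms(2) by simp
  have Lp: "Lp_fun (lebesgue_on (ball 0 (real n))) p (\<lambda>y. \<bar>u y\<bar>)" using u by (auto simp: mass_fun_def)
  have "ball_norm p u (real n) = 0"
  proof -
    obtain c where "c > 0" "ball_norm p u (real n) \<le> c * mass_norm p q b u"
      using ball_norm_le_mass_norm[OF exponents(1,2) b, of "real n"] u by metis
    moreover have "c * mass_norm p q b u \<le> 0" using m0 \<open>c > 0\<close> by (simp add: mult_nonneg_nonpos)
    ultimately show ?thesis using ball_norm_nonneg[of p u "real n"] by simp
  qed
  then show "AE x in lebesgue_on (ball 0 (real n)). u x = 0"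
    using Lp_norm_eq_0_iff[OF exponents(1) Lp] by (simp add: ball_norm_def)
qed

section \<open>Uniform convexity of the norm\<close>

text \<open>The modulus is transported from points to balls, from balls to radii, from points to the gradient
  norm, and from both norms to their pair.\<close>

lemma rep_norm_uniformly_convex:
  obtains \<delta> where "\<And>\<epsilon>. \<epsilon> > 0 \<Longrightarrow> \<delta> \<epsilon> > 0"
    and "\<And>(u :: 'a::euclidean_space \<Rightarrow> real) v G H. \<lbrakk>E_rep p q b u G; E_rep p q b v H\<rbrakk> \<Longrightarrow>
      uc_quad \<delta> (rep_norm p q b u G) (rep_norm p q b v H)
        (rep_norm p q b (\<lambda>x. 1 / 2 * (u x + v x)) (\<lambda>x. (1 / 2) *\<^sub>R (G x + H x)))
        (rep_norm p q b (\<lambda>x. u x - v x) (\<lambda>x. G x - H x))"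
proof -
  let ?\<delta>0 = "\<lambda>\<epsilon>::real. \<epsilon>\<^sup>2 / 8"
  have \<delta>0: "\<And>\<epsilon>. \<epsilon> > 0 \<Longrightarrow> ?\<delta>0 \<epsilon> > 0" by simp
  show thesis
  proof (rule uc_quad_Lp_norm[OF p \<delta>0])
    fix \<delta>1 assume \<delta>1: "\<And>\<epsilon>. \<epsilon> > 0 \<Longrightarrow> \<delta>1 \<epsilon> > 0"
      and ball: "\<And>(M :: 'a measure) f g m d. \<lbrakk>Lp_fun M p f; Lp_fun M p g; Lp_fun M p m; Lp_fun M p d;
        \<And>x. x \<in> space M \<Longrightarrow> uc_quad ?\<delta>0 (f x) (g x) (m x) (d x)\<rbrakk>
        \<Longrightarrow> uc_quad \<delta>1 (Lp_norm M p f) (Lp_norm M p g) (Lp_norm M p m) (Lp_norm M p d)"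
    show thesis
    proof (rule uc_quad_Lp_norm[OF exponents(5) \<delta>1])
      fix \<delta>2 assume \<delta>2: "\<And>\<epsilon>. \<epsilon> > 0 \<Longrightarrow> \<delta>2 \<epsilon> > 0"
        and rad: "\<And>(M :: real measure) f g m d. \<lbrakk>Lp_fun M (p * q) f; Lp_fun M (p * q) g; Lp_fun M (p * q) m;
          Lp_fun M (p * q) d; \<And>x. x \<in> space M \<Longrightarrow> uc_quad \<delta>1 (f x) (g x) (m x) (d x)\<rbrakk>
          \<Longrightarrow> uc_quad \<delta>2 (Lp_norm M (p * q) f) (Lp_norm M (p * q) g) (Lp_norm M (p * q) m) (Lp_norm M (p * q) d)"
      show thesis
      proof (rule uc_quad_Lp_norm[OF _ \<delta>0])
        show "1 < (2 :: real)" by simp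
        fix \<delta>3 assume \<delta>3: "\<And>\<epsilon>. \<epsilon> > 0 \<Longrightarrow> \<delta>3 \<epsilon> > 0"
          and grd: "\<And>(M :: 'a measure) f g m d. \<lbrakk>Lp_fun M 2 f; Lp_fun M 2 g; Lp_fun M 2 m; Lp_fun M 2 d;
            \<And>x. x \<in> space M \<Longrightarrow> uc_quad ?\<delta>0 (f x) (g x) (m x) (d x)\<rbrakk>
            \<Longrightarrow> uc_quad \<delta>3 (Lp_norm M 2 f) (Lp_norm M 2 g) (Lp_norm M 2 m) (Lp_norm M 2 d)"
        let ?\<delta>4 = "\<lambda>\<epsilon>. min (\<delta>2 \<epsilon>) (\<delta>3 \<epsilon>)"
        have \<delta>4: "\<And>\<epsilon>. \<epsilon> > 0 \<Longrightarrow> ?\<delta>4 \<epsilon> > 0" using \<delta>2 \<delta>3 by simp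
        show thesis
        proof (rule uc_quad_Lp_norm[OF exponents(7) \<delta>4])
          fix \<delta>5 assume \<delta>5: "\<And>\<epsilon>. \<epsilon> > 0 \<Longrightarrow> \<delta>5 \<epsilon> > 0"
            and two: "\<And>(M :: bool measure) f g m d. \<lbrakk>Lp_fun M (2 * p * q) f; Lp_fun M (2 * p * q) g;
              Lp_fun M (2 * p * q) m; Lp_fun M (2 * p * q) d;
              \<And>x. x \<in> space M \<Longrightarrow> uc_quad ?\<delta>4 (f x) (g x) (m x) (d x)\<rbrakk>
              \<Longrightarrow> uc_quad \<delta>5 (Lp_norm M (2 * p * q) f) (Lp_norm M (2 * p * q) g)
                (Lp_norm M (2 * p * q) m) (Lp_norm M (2 * p * q) d)"
          show thesis
          proof (rule that[of \<delta>5, OF \<delta>5])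
            fix u v :: "'a \<Rightarrow> real" and G H
            assume u: "E_rep p q b u G" and v: "E_rep p q b v H"
            let ?w = "\<lambda>x. 1 / 2 * (u x + v x)" and ?K = "\<lambda>x. (1 / 2) *\<^sub>R (G x + H x)"
            let ?z = "\<lambda>x. u x - v x" and ?J = "\<lambda>x. G x - H x"
            have w: "E_rep p q b ?w ?K" and z: "E_rep p q b ?z ?J"
              using E_rep_scale(1)[OF E_rep_add(1)[OF u v], of "1 / 2"] E_rep_diff[OF u v] by auto
            have 1: "uc_quad \<delta>1 (ball_norm p u \<rho>) (ball_norm p v \<rho>) (ball_norm p ?w \<rho>) (ball_norm p ?z \<rho>)" for \<rho>
              unfolding ball_norm_def
            proof (rule ball)
              show "uc_quad ?\<delta>0 \<bar>u x\<bar> \<bar>v x\<bar> \<bar>?w x\<bar> \<bar>?z x\<bar>" for x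
                using uc_quad_inner[of "u x" "v x"] by simp
            qed (use u v w z in \<open>auto simp: E_rep_def mass_fun_def\<close>)
            have 2: "uc_quad ?\<delta>4 (mass_norm p q b u) (mass_norm p q b v) (mass_norm p q b ?w) (mass_norm p q b ?z)"
              unfolding mass_norm_def
            proof (rule uc_quad_mono[OF rad])
              show "uc_quad \<delta>1 (ball_norm p u \<rho>) (ball_norm p v \<rho>) (ball_norm p ?w \<rho>) (ball_norm p ?z \<rho>)" for \<rho>
                by (rule 1)
            qed (use u v w z in \<open>auto simp: E_rep_def mass_fun_def\<close>)
            have 3: "uc_quad ?\<delta>4 (Lp_norm lebesgue 2 (\<lambda>x. norm (G x))) (Lp_norm lebesgue 2 (\<lambda>x. norm (H x)))
                (Lp_norm lebesgue 2 (\<lambda>x. norm (?K x))) (Lp_norm lebesgue 2 (\<lambda>x. norm (?J x)))"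
            proof (rule uc_quad_mono[OF grd])
              show "uc_quad ?\<delta>0 (norm (G x)) (norm (H x)) (norm (?K x)) (norm (?J x))" for x
                by (rule uc_quad_inner)
            qed (use u v w z in \<open>auto simp: E_rep_def\<close>)
            show "uc_quad \<delta>5 (rep_norm p q b u G) (rep_norm p q b v H) (rep_norm p q b ?w ?K) (rep_norm p q b ?z ?J)"
              unfolding rep_norm_def pair_norm_def
            proof (rule two)
              show "uc_quad ?\<delta>4
                 (if i then Lp_norm lebesgue 2 (\<lambda>x. norm (G x)) else mass_norm p q b u)
                 (if i then Lp_norm lebesgue 2 (\<lambda>x. norm (H x)) else mass_norm p q b v)
                 (if i then Lp_norm lebesgue 2 (\<lambda>x. norm (?K x)) else mass_norm p q b ?w)
                 (if i then Lp_norm lebesgue 2 (\<lambda>x. norm (?J x)) else mass_norm p q b ?z)" for i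
                using 2 3 by (cases i) auto
            qed (intro Lp_fun_pair Lp_norm_nonneg mass_norm_nonneg)+
          qed
        qed
      qed
    qed
  qed
qed

section \<open>Completeness\<close>

lemma rep_norm_complete:
  fixes u :: "nat \<Rightarrow> 'a::euclidean_space \<Rightarrow> real"
  assumes E: "\<And>n. E_rep p q b (u n) (G n)"
    and Cauchy: "\<And>e. e > 0 \<Longrightarrow> \<exists>M. \<forall>m\<ge>M. \<forall>n\<ge>M. rep_norm p q b (\<lambda>x. u m x - u n x) (\<lambda>x. G m x - G n x) < e"
  shows "\<exists>U \<Gamma>. E_rep p q b U \<Gamma> \<and> (\<lambda>n. rep_norm p q b (\<lambda>x. u n x - U x) (\<lambda>x. G n x - \<Gamma> x)) \<longlonglongrightarrow> 0"
proof -
  define D where "D m n = rep_norm p q b (\<lambda>x. u m x - u n x) (\<lambda>x. G m x - G n x)" for m n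
  have Ed: "E_rep p q b (\<lambda>x. u m x - u n x) (\<lambda>x. G m x - G n x)" for m n
    by (rule E_rep_diff[OF E E])
  have mass_d: "mass_fun p q b (\<lambda>x. u m x - u n x)" and Lp2_d: "Lp_fun lebesgue 2 (\<lambda>x. norm (G m x - G n x))" for m n
    using Ed by (auto simp: E_rep_def)
  have D_mass: "mass_norm p q b (\<lambda>x. u m x - u n x) \<le> D m n"
    and D_grad: "Lp_norm lebesgue 2 (\<lambda>x. norm (G m x - G n x)) \<le> D m n" for m n
    unfolding D_def by (rule rep_norm_ge)+
  have mu[measurable]: "u n \<in> borel_measurable lebesgue" and mG[measurable]: "G n \<in> borel_measurable lebesgue" for n
    using E_rep_measurable[OF E] by auto
  have "\<exists>c>0. \<forall>w :: 'a \<Rightarrow> real. mass_fun p q b w \<longrightarrow> ball_norm p w \<rho> \<le> c * mass_norm p q b w" for \<rho>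
    using ball_norm_le_mass_norm[OF exponents(1,2) b, of \<rho>] by metis
  then obtain c where c: "\<And>\<rho>. c \<rho> > 0"
    "\<And>\<rho> w :: 'a \<Rightarrow> real. mass_fun p q b w \<Longrightarrow> ball_norm p w \<rho> \<le> c \<rho> * mass_norm p q b w"
    by metis
  have D_ball: "ball_norm p (\<lambda>x. u m x - u n x) \<rho> \<le> c \<rho> * D m n" for m n \<rho>
    using c(2)[OF mass_d[of m n], of \<rho>] mult_left_mono[OF D_mass[of m n] less_imp_le[OF c(1)[of \<rho>]]] by linarith
  have Lp_d: "Lp_fun (lebesgue_on (ball 0 \<rho>)) p (\<lambda>x. \<bar>u m x - u n x\<bar>)" for m n \<rho>
    using mass_d by (auto simp: mass_fun_def)
  \<comment> \<open>a subsequence along which successive distances decay geometrically\<close>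
  have "\<exists>M. \<forall>m\<ge>M. \<forall>n\<ge>M. D m n < (1 / 2) ^ k" for k
    unfolding D_def by (rule Cauchy) simp
  then obtain M where M: "\<And>k m n. m \<ge> M k \<Longrightarrow> n \<ge> M k \<Longrightarrow> D m n < (1 / 2) ^ k" by metis
  define r where "r k = (\<Sum>i\<le>k. M i) + k" for k
  have rM: "M k \<le> r k" "k \<le> r k" for k
    unfolding r_def by (auto intro: trans_le_add1 member_le_sum)
  have r_Suc: "r k \<le> r (Suc k)" for k by (simp add: r_def)
  have D_step: "D (r (Suc k)) (r k) \<le> (1 / 2) ^ k" for k
    using M[of k "r (Suc k)" "r k"] rM(1)[of k] r_Suc[of k] by simp
  define U where "U x = lim (\<lambda>k. u (r k) x)" for x
  define \<Gamma> where "\<Gamma> x = lim (\<lambda>k. G (r k) x)" for x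
  have mU[measurable]: "U \<in> borel_measurable lebesgue" unfolding U_def[abs_def] by measurable
  have m\<Gamma>[measurable]: "\<Gamma> \<in> borel_measurable lebesgue" unfolding \<Gamma>_def[abs_def] by measurable
  have ae_u: "AE x in lebesgue. (\<lambda>k. u (r k) x) \<longlonglongrightarrow> U x"
    unfolding U_def
  proof (rule fast_subsequence_converges[OF exponents(3)])
    show "Lp_fun (lebesgue_on (ball 0 (real n))) p (\<lambda>x. norm (u (r (Suc k)) x - u (r k) x))" for k n
      using Lp_d by simp
    show "Lp_norm (lebesgue_on (ball 0 (real n))) p (\<lambda>x. norm (u (r (Suc k)) x - u (r k) x)) \<le> c (real n) * (1 / 2) ^ k" for k n
      using D_ball[of "r (Suc k)" "r k" "real n"] mult_left_mono[OF D_step[of k] less_imp_le[OF c(1)[of "real n"]]]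
      by (simp add: ball_norm_def)
  qed
  have ae_G: "AE x in lebesgue. (\<lambda>k. G (r k) x) \<longlonglongrightarrow> \<Gamma> x"
    unfolding \<Gamma>_def
  proof (rule fast_subsequence_converges[where s = 2 and C = "\<lambda>_. 1"])
    show "Lp_fun (lebesgue_on (ball 0 (real n))) 2 (\<lambda>x. norm (G (r (Suc k)) x - G (r k) x))" for k n
      by (rule Lp_restrict(1)[OF _ Lp2_d]) auto
    show "Lp_norm (lebesgue_on (ball 0 (real n))) 2 (\<lambda>x. norm (G (r (Suc k)) x - G (r k) x)) \<le> 1 * (1 / 2) ^ k" for k n
      using Lp_restrict(2)[OF _ Lp2_d, of "ball 0 (real n)" "r (Suc k)" "r k"] D_grad[of "r (Suc k)" "r k"] D_step[of k]
      by simp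
  qed simp
  \<comment> \<open>by Fatou's lemma, bounds on \<open>D n m\<close> for large \<open>m\<close> pass to the limit\<close>
  have ball_lim: "Lp_fun (lebesgue_on (ball 0 \<rho>)) p (\<lambda>x. \<bar>u n x - U x\<bar>)" "ball_norm p (\<lambda>x. u n x - U x) \<rho> \<le> c \<rho> * e"
    if le: "\<And>m. m \<ge> M0 \<Longrightarrow> D n m \<le> e" for n M0 e \<rho>
  proof -
    let ?f = "\<lambda>k x. \<bar>u n x - u (r (k + M0)) x\<bar>"
    have D_le: "D n (r (k + M0)) \<le> e" for k using rM(2)[of "k + M0"] by (intro le) simp
    have f1: "Lp_fun (lebesgue_on (ball 0 \<rho>)) p (?f k)" for k by (rule Lp_d)
    have f2: "Lp_norm (lebesgue_on (ball 0 \<rho>)) p (?f k) \<le> c \<rho> * e" for k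
      using D_ball[of n "r (k + M0)" \<rho>] mult_left_mono[OF D_le[of k] less_imp_le[OF c(1)[of \<rho>]]]
      by (simp add: ball_norm_def)
    have f3: "AE x in lebesgue_on (ball 0 \<rho>). (\<lambda>k. ?f k x) \<longlonglongrightarrow> \<bar>u n x - U x\<bar>"
    proof (subst AE_restrict_space_iff)
      show "AE x in lebesgue. x \<in> ball 0 \<rho> \<longrightarrow> (\<lambda>k. ?f k x) \<longlonglongrightarrow> \<bar>u n x - U x\<bar>"
        using ae_u
      proof eventually_elim
        case (elim x)
        then show ?case by (intro impI tendsto_intros LIMSEQ_ignore_initial_segment)
      qed
    qed auto
    have f4: "(\<lambda>x. \<bar>u n x - U x\<bar>) \<in> borel_measurable (lebesgue_on (ball 0 \<rho>))"
      by (intro measurable_restrict_space1) measurable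
    note F = Lp_Fatou[OF exponents(1) f1 f2 f3 f4 abs_ge_zero]
    show "Lp_fun (lebesgue_on (ball 0 \<rho>)) p (\<lambda>x. \<bar>u n x - U x\<bar>)" "ball_norm p (\<lambda>x. u n x - U x) \<rho> \<le> c \<rho> * e"
      using F by (simp_all add: ball_norm_def)
  qed
  have grad_lim: "Lp_fun lebesgue 2 (\<lambda>x. norm (G n x - \<Gamma> x))" "Lp_norm lebesgue 2 (\<lambda>x. norm (G n x - \<Gamma> x)) \<le> e"
    if le: "\<And>m. m \<ge> M0 \<Longrightarrow> D n m \<le> e" for n M0 e
  proof -
    let ?f = "\<lambda>k x. norm (G n x - G (r (k + M0)) x)"
    have D_le: "D n (r (k + M0)) \<le> e" for k using rM(2)[of "k + M0"] by (intro le) simp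
    have f2: "Lp_norm lebesgue 2 (?f k) \<le> e" for k
      using D_grad[of n "r (k + M0)"] D_le[of k] by simp
    have f3: "AE x in lebesgue. (\<lambda>k. ?f k x) \<longlonglongrightarrow> norm (G n x - \<Gamma> x)"
      using ae_G
    proof eventually_elim
      case (elim x)
      then show ?case by (intro tendsto_intros LIMSEQ_ignore_initial_segment)
    qed
    have f4: "(\<lambda>x. norm (G n x - \<Gamma> x)) \<in> borel_measurable lebesgue" by measurable
    show "Lp_fun lebesgue 2 (\<lambda>x. norm (G n x - \<Gamma> x))" "Lp_norm lebesgue 2 (\<lambda>x. norm (G n x - \<Gamma> x)) \<le> e"
      using Lp_Fatou[OF _ Lp2_d f2 f3 f4 norm_ge_zero] by simp_all
  qed
  have ev: "\<exists>M0. \<forall>n\<ge>M0. \<forall>m\<ge>M0. D n m \<le> e" if "e > 0" for e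
    using Cauchy[OF that] unfolding D_def by (meson less_imp_le)
  \<comment> \<open>for each fixed \<open>n\<close>, the distances \<open>D n m\<close> are bounded for large \<open>m\<close>, hence \<open>u n - U\<close> has finite norms\<close>
  obtain n0 where n0: "\<And>m. m \<ge> n0 \<Longrightarrow> D n0 m \<le> 1" using ev[of 1] by auto
  have D_bd: "D n m \<le> D n n0 + 1" if "m \<ge> n0" for n m
  proof -
    have "D n m \<le> D n n0 + D n0 m"
      using E_rep_add(2)[OF Ed[of n n0] Ed[of n0 m]] by (simp add: D_def)
    then show ?thesis using n0[OF that] by simp
  qed
  have Lp_u: "Lp_fun (lebesgue_on (ball 0 \<rho>)) p (\<lambda>x. \<bar>u n x - U x\<bar>)" for n \<rho>
    by (rule ball_lim(1)[of n0 n "D n n0 + 1"]) (rule D_bd)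
  have Lp_G: "Lp_fun lebesgue 2 (\<lambda>x. norm (G n x - \<Gamma> x))" for n
    by (rule grad_lim(1)[of n0 n "D n n0 + 1"]) (rule D_bd)
  have ball_to_0: "(\<lambda>n. ball_norm p (\<lambda>x. u n x - U x) \<rho>) \<longlonglongrightarrow> 0" for \<rho>
  proof (rule LIMSEQ_I)
    fix e :: real assume "e > 0"
    then have e': "e / (2 * c \<rho>) > 0" using c(1)[of \<rho>] by simp
    obtain M0 where M0: "\<And>n m. n \<ge> M0 \<Longrightarrow> m \<ge> M0 \<Longrightarrow> D n m \<le> e / (2 * c \<rho>)" using ev[OF e'] by auto
    have "ball_norm p (\<lambda>x. u n x - U x) \<rho> < e" if "n \<ge> M0" for n
      using ball_lim(2)[of M0 n "e / (2 * c \<rho>)" \<rho>] M0[OF that] c(1)[of \<rho>] \<open>e > 0\<close> by simp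
    then show "\<exists>M0. \<forall>n\<ge>M0. norm (ball_norm p (\<lambda>x. u n x - U x) \<rho> - 0) < e"
      by (intro exI[of _ M0]) (auto simp: ball_norm_nonneg)
  qed
  have mball: "ball_norm p (\<lambda>x. u n x - U x) \<in> borel_measurable (radial b)" for n
    by (rule borel_measurable_ball_norm[OF exponents(1) _ Lp_u]) measurable
  have mass_lim: "Lp_fun (radial b) (p * q) (ball_norm p (\<lambda>x. u n x - U x))" "mass_norm p q b (\<lambda>x. u n x - U x) \<le> e"
    if le: "\<And>m. m \<ge> M0 \<Longrightarrow> D n m \<le> e" for n M0 e
  proof -
    \<comment> \<open>the ball norms converge at every radius, so Fatou's lemma applies over the radii\<close>
    let ?f = "\<lambda>k. ball_norm p (\<lambda>x. u n x - u (r (k + M0)) x)"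
    have D_le: "D n (r (k + M0)) \<le> e" for k using rM(2)[of "k + M0"] by (intro le) simp
    have f1: "Lp_fun (radial b) (p * q) (?f k)" for k using mass_d by (auto simp: mass_fun_def)
    have f2: "Lp_norm (radial b) (p * q) (?f k) \<le> e" for k
      using D_mass[of n "r (k + M0)"] D_le[of k] by (simp add: mass_norm_def)
    have r_top: "filterlim (\<lambda>k. r (k + M0)) at_top sequentially"
      by (rule filterlim_at_top_mono[OF filterlim_ident])
         (use rM(2) in \<open>auto intro!: always_eventually intro: order_trans[OF le_add1]\<close>)
    have f3: "(\<lambda>k. ?f k \<rho>) \<longlonglongrightarrow> ball_norm p (\<lambda>x. u n x - U x) \<rho>" for \<rho>
    proof (rule LIM_zero_cancel, rule Lim_null_comparison)
      show "(\<lambda>k. ball_norm p (\<lambda>x. u (r (k + M0)) x - U x) \<rho>) \<longlonglongrightarrow> 0"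
        by (rule filterlim_compose[OF ball_to_0 r_top])
      show "eventually (\<lambda>k. norm (?f k \<rho> - ball_norm p (\<lambda>x. u n x - U x) \<rho>)
          \<le> ball_norm p (\<lambda>x. u (r (k + M0)) x - U x) \<rho>) sequentially"
      proof (intro always_eventually allI)
        fix k
        let ?l = "r (k + M0)"
        have m: "(\<lambda>x. \<bar>u n x - u ?l x\<bar>) \<in> borel_measurable (lebesgue_on (ball 0 \<rho>))"
          "(\<lambda>x. \<bar>u n x - U x\<bar>) \<in> borel_measurable (lebesgue_on (ball 0 \<rho>))"
          by (intro measurable_restrict_space1; measurable)+
        have "?f k \<rho> \<le> ball_norm p (\<lambda>x. u n x - U x) \<rho> + ball_norm p (\<lambda>x. u ?l x - U x) \<rho>"
          unfolding ball_norm_def by (rule Lp_triangle(2)[OF exponents(3) Lp_u Lp_u m(1)]) auto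
        moreover have "ball_norm p (\<lambda>x. u n x - U x) \<rho> \<le> ?f k \<rho> + ball_norm p (\<lambda>x. u ?l x - U x) \<rho>"
          unfolding ball_norm_def by (rule Lp_triangle(2)[OF exponents(3) Lp_d Lp_u m(2)]) auto
        ultimately show "norm (?f k \<rho> - ball_norm p (\<lambda>x. u n x - U x) \<rho>) \<le> ball_norm p (\<lambda>x. u ?l x - U x) \<rho>"
          by simp
      qed
    qed
    show "Lp_fun (radial b) (p * q) (ball_norm p (\<lambda>x. u n x - U x))" "mass_norm p q b (\<lambda>x. u n x - U x) \<le> e"
      using Lp_Fatou[OF exponents(4) f1 f2 AE_I2[OF f3] mball ball_norm_nonneg] by (simp_all add: mass_norm_def)
  qed
  have mass_u: "mass_fun p q b (\<lambda>x. u n x - U x)" for n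
  proof -
    have "Lp_fun (radial b) (p * q) (ball_norm p (\<lambda>x. u n x - U x))"
      by (rule mass_lim(1)[of n0 n "D n n0 + 1"]) (rule D_bd)
    then show ?thesis using Lp_u by (simp add: mass_fun_def)
  qed
  have mass_U: "mass_fun p q b U"
  proof (rule mass_fun_subadditive(1)[OF _ mass_u[of n0]])
    show "mass_fun p q b (u n0)" using E by (auto simp: E_rep_def)
  qed auto
  have Lp_\<Gamma>: "Lp_fun lebesgue 2 (\<lambda>x. norm (\<Gamma> x))"
  proof (rule Lp_triangle(1)[OF _ _ Lp_G[of n0]])
    show "Lp_fun lebesgue 2 (\<lambda>x. norm (G n0 x))" using E by (auto simp: E_rep_def)
    show "norm (\<Gamma> x) \<le> norm (G n0 x) + norm (G n0 x - \<Gamma> x)" for x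
      using norm_triangle_ineq4[of "G n0 x" "G n0 x - \<Gamma> x"] by simp
  qed auto
  have grad_to_0: "(\<lambda>n. Lp_norm lebesgue 2 (\<lambda>x. norm (G n x - \<Gamma> x))) \<longlonglongrightarrow> 0"
  proof (rule LIMSEQ_I)
    fix e :: real assume "e > 0"
    then obtain M0 where M0: "\<And>n m. n \<ge> M0 \<Longrightarrow> m \<ge> M0 \<Longrightarrow> D n m \<le> e / 2" using ev[of "e / 2"] by auto
    have "Lp_norm lebesgue 2 (\<lambda>x. norm (G n x - \<Gamma> x)) < e" if "n \<ge> M0" for n
      using grad_lim(2)[of M0 n "e / 2"] M0[OF that] \<open>e > 0\<close> by simp
    then show "\<exists>M0. \<forall>n\<ge>M0. norm (Lp_norm lebesgue 2 (\<lambda>x. norm (G n x - \<Gamma> x)) - 0) < e"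
      by (intro exI[of _ M0]) (auto simp: Lp_norm_nonneg)
  qed
  have wg: "has_weak_gradient U \<Gamma>"
  proof (rule has_weak_gradient_limit)
    show "has_weak_gradient (u k) (G k)" for k using E by (auto simp: E_rep_def)
    show "locally_integrable U"
      using mass_U by (intro locally_integrable_of_Lp[OF exponents(3) mU]) (auto simp: mass_fun_def)
    show "locally_integrable \<Gamma>"
      by (rule locally_integrable_of_Lp[OF _ m\<Gamma> Lp_restrict(1)[OF _ Lp_\<Gamma>]]) auto
    fix K :: "'a set" assume K: "compact K"
    show "(\<lambda>k. LINT x|lebesgue. indicator K x * norm (u k x - U x)) \<longlonglongrightarrow> 0"
      using Lp_u ball_to_0 by (intro local_L1_tendsto[OF exponents(3) K]) (auto simp: ball_norm_def)
    show "(\<lambda>k. LINT x|lebesgue. indicator K x * norm (G k x - \<Gamma> x)) \<longlonglongrightarrow> 0"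
    proof (rule local_L1_tendsto[OF _ K])
      fix \<rho>
      show "(\<lambda>k. Lp_norm (lebesgue_on (ball 0 \<rho>)) 2 (\<lambda>x. norm (G k x - \<Gamma> x))) \<longlonglongrightarrow> 0"
      proof (rule tendsto_sandwich[OF _ _ tendsto_const grad_to_0])
        show "eventually (\<lambda>k. Lp_norm (lebesgue_on (ball 0 \<rho>)) 2 (\<lambda>x. norm (G k x - \<Gamma> x))
            \<le> Lp_norm lebesgue 2 (\<lambda>x. norm (G k x - \<Gamma> x))) sequentially"
          by (intro always_eventually allI Lp_restrict(2)[OF _ Lp_G]) auto
      qed (simp add: Lp_norm_nonneg)
    qed (auto intro: Lp_restrict(1)[OF _ Lp_G])
  qed
  have EU: "E_rep p q b U \<Gamma>" using wg Lp_\<Gamma> mass_U by (simp add: E_rep_def)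
  have "(\<lambda>n. rep_norm p q b (\<lambda>x. u n x - U x) (\<lambda>x. G n x - \<Gamma> x)) \<longlonglongrightarrow> 0"
  proof (rule LIMSEQ_I)
    fix e :: real assume "e > 0"
    then obtain M0 where M0: "\<And>n m. n \<ge> M0 \<Longrightarrow> m \<ge> M0 \<Longrightarrow> D n m \<le> e / 3" using ev[of "e / 3"] by auto
    have "rep_norm p q b (\<lambda>x. u n x - U x) (\<lambda>x. G n x - \<Gamma> x) < e" if "n \<ge> M0" for n
    proof -
      have "rep_norm p q b (\<lambda>x. u n x - U x) (\<lambda>x. G n x - \<Gamma> x)
          \<le> Lp_norm lebesgue 2 (\<lambda>x. norm (G n x - \<Gamma> x)) + mass_norm p q b (\<lambda>x. u n x - U x)"
        unfolding rep_norm_def by (intro pair_norm_le_add exponents Lp_norm_nonneg mass_norm_nonneg)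
      also have "\<dots> \<le> e / 3 + e / 3"
        using grad_lim(2)[of M0 n "e / 3"] mass_lim(2)[of M0 n "e / 3"] M0[OF that] by (intro add_mono) auto
      finally show ?thesis using \<open>e > 0\<close> by simp
    qed
    then show "\<exists>M0. \<forall>n\<ge>M0. norm (rep_norm p q b (\<lambda>x. u n x - U x) (\<lambda>x. G n x - \<Gamma> x) - 0) < e"
      by (intro exI[of _ M0]) (auto simp: rep_norm_nonneg)
  qed
  with EU show ?thesis by blast
qed

section \<open>Passage to equivalence classes\<close>

lemma E_spaceE:
  fixes X :: "('a::euclidean_space \<Rightarrow> real) set"
  assumes "X \<in> E_space p q b"
  obtains u G where "X = ae_eq `` {u}" "E_rep p q b u G"
proof -
  obtain u where "u \<in> E_fun p q b" "X = ae_eq `` {u}"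
    using assms unfolding E_space_def by (rule quotientE)
  then show thesis using that E_fun_E_rep by blast
qed

lemma E_rep_E_space: "E_rep p q b u G \<Longrightarrow> ae_eq `` {u} \<in> E_space p q b"
  unfolding E_space_def by (intro quotientI E_rep_E_fun(1))

lemma E_norm_class:
  fixes u :: "'a::euclidean_space \<Rightarrow> real"
  assumes "E_rep p q b u G"
  shows "E_norm p q b (ae_eq `` {u}) = rep_norm p q b u G"
proof -
  have "E_fun_norm p q b v = rep_norm p q b u G" if "v \<in> ae_eq `` {u}" for v
    using E_rep_cong_AE[OF assms, of v] E_rep_E_fun(2)[of v G] that by (simp add: ae_eq_iff)
  moreover have "u \<in> ae_eq `` {u}" by (simp add: ae_eq_iff)
  ultimately have "E_fun_norm p q b ` (ae_eq `` {u}) = {rep_norm p q b u G}"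
    by (auto intro!: image_eqI[of _ _ u])
  then show ?thesis by (simp add: E_norm_def)
qed

lemma E_norm_class_diff:
  fixes u v :: "'a::euclidean_space \<Rightarrow> real"
  assumes "E_rep p q b u G" "E_rep p q b v H"
  shows "E_norm p q b (ae_add (ae_eq `` {u}) (ae_scale (- 1) (ae_eq `` {v})))
    = rep_norm p q b (\<lambda>x. u x - v x) (\<lambda>x. G x - H x)"
  using E_norm_class[OF E_rep_diff[OF assms]] by (simp add: ae_add_class ae_scale_class)

theorem E_space_uniformly_convex_banach:
  "uniformly_convex_banach_space_on
    (E_space p q b :: ('a::euclidean_space \<Rightarrow> real) set set) ae_zero ae_add ae_scale (E_norm p q b)"
proof unfold_locales
  let ?V = "E_space p q b :: ('a \<Rightarrow> real) set set"
  show "ae_zero \<in> ?V"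
    unfolding ae_zero_def by (rule E_rep_E_space[OF E_rep_zero(1)])
  fix X Y Z :: "('a \<Rightarrow> real) set" and c d :: real
  {
    assume "X \<in> ?V"
    then obtain u G where u: "X = ae_eq `` {u}" "E_rep p q b u G" by (rule E_spaceE)
    show "ae_scale c X \<in> ?V"
      unfolding u(1) ae_scale_class by (rule E_rep_E_space[OF E_rep_scale(1)[OF u(2)]])
    show "ae_add X ae_zero = X" "ae_add X (ae_scale (- 1) X) = ae_zero"
      "ae_scale (c + d) X = ae_add (ae_scale c X) (ae_scale d X)"
      "ae_scale c (ae_scale d X) = ae_scale (c * d) X" "ae_scale 1 X = X"
      by (simp_all add: u(1) ae_zero_def ae_scale_class ae_add_class algebra_simps)
    show "E_norm p q b X \<ge> 0"
      unfolding u(1) E_norm_class[OF u(2)] by (rule rep_norm_nonneg)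
    show "E_norm p q b (ae_scale c X) = \<bar>c\<bar> * E_norm p q b X"
      unfolding u(1) ae_scale_class E_norm_class[OF u(2)] E_norm_class[OF E_rep_scale(1)[OF u(2)]]
      by (rule E_rep_scale(2)[OF u(2)])
    show "E_norm p q b X = 0 \<longleftrightarrow> X = ae_zero"
    proof
      assume "E_norm p q b X = 0"
      then have "AE x in lebesgue. u x = 0"
        using rep_norm_eq_0_imp[OF u(2)] by (simp add: u(1) E_norm_class[OF u(2)])
      then show "X = ae_zero" by (simp add: u(1) ae_zero_def ae_class_eq_iff)
    next
      assume "X = ae_zero"
      then show "E_norm p q b X = 0"
        by (simp add: ae_zero_def E_norm_class[OF E_rep_zero(1)] E_rep_zero(2))
    qed
    assume "Y \<in> ?V"
    then obtain v H where v: "Y = ae_eq `` {v}" "E_rep p q b v H" by (rule E_spaceE)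
    show "ae_add X Y \<in> ?V"
      unfolding u(1) v(1) ae_add_class by (rule E_rep_E_space[OF E_rep_add(1)[OF u(2) v(2)]])
    show "ae_add X Y = ae_add Y X" "ae_scale c (ae_add X Y) = ae_add (ae_scale c X) (ae_scale c Y)"
      by (simp_all add: u(1) v(1) ae_scale_class ae_add_class algebra_simps)
    show "E_norm p q b (ae_add X Y) \<le> E_norm p q b X + E_norm p q b Y"
      unfolding u(1) v(1) ae_add_class E_norm_class[OF u(2)] E_norm_class[OF v(2)]
        E_norm_class[OF E_rep_add(1)[OF u(2) v(2)]]
      by (rule E_rep_add(2)[OF u(2) v(2)])
    assume "Z \<in> ?V"
    then obtain w K where w: "Z = ae_eq `` {w}" "E_rep p q b w K" by (rule E_spaceE)
    show "ae_add (ae_add X Y) Z = ae_add X (ae_add Y Z)"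
      by (simp add: u(1) v(1) w(1) ae_add_class algebra_simps)
  }
next
  fix X :: "nat \<Rightarrow> ('a \<Rightarrow> real) set"
  assume X: "\<And>n. X n \<in> E_space p q b"
    and Cauchy: "\<forall>e>0. \<exists>M. \<forall>m\<ge>M. \<forall>n\<ge>M. E_norm p q b (ae_add (X m) (ae_scale (- 1) (X n))) < e"
  have "\<exists>u G. X n = ae_eq `` {u} \<and> E_rep p q b u G" for n
    using E_spaceE[OF X[of n]] by metis
  then obtain u G where u: "\<And>n. X n = ae_eq `` {u n}" "\<And>n. E_rep p q b (u n) (G n)" by metis
  have "\<exists>M. \<forall>m\<ge>M. \<forall>n\<ge>M. rep_norm p q b (\<lambda>x. u m x - u n x) (\<lambda>x. G m x - G n x) < e" if "e > 0" for e
    using Cauchy that by (simp add: u(1) E_norm_class_diff[OF u(2) u(2)])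
  from rep_norm_complete[OF u(2) this] obtain U \<Gamma> where U: "E_rep p q b U \<Gamma>"
    "(\<lambda>n. rep_norm p q b (\<lambda>x. u n x - U x) (\<lambda>x. G n x - \<Gamma> x)) \<longlonglongrightarrow> 0" by blast
  show "\<exists>x\<in>E_space p q b. (\<lambda>n. E_norm p q b (ae_add (X n) (ae_scale (- 1) x))) \<longlonglongrightarrow> 0"
    using E_rep_E_space[OF U(1)] U(2)
    by (intro bexI[of _ "ae_eq `` {U}"]) (simp_all add: u(1) E_norm_class_diff[OF u(2) U(1)])
next
  fix e :: real assume e: "0 < e" "e \<le> 2"
  show "\<exists>d>0. \<forall>x\<in>E_space p q b :: ('a \<Rightarrow> real) set set. \<forall>y\<in>E_space p q b.
      E_norm p q b x = 1 \<and> E_norm p q b y = 1 \<and> E_norm p q b (ae_add x (ae_scale (- 1) y)) \<ge> e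
        \<longrightarrow> E_norm p q b (ae_scale (1 / 2) (ae_add x y)) \<le> 1 - d"
  proof (rule rep_norm_uniformly_convex)
    fix \<delta> assume \<delta>: "\<And>\<epsilon>. \<epsilon> > 0 \<Longrightarrow> \<delta> \<epsilon> > 0"
      and uc: "\<And>(u :: 'a \<Rightarrow> real) v G H. \<lbrakk>E_rep p q b u G; E_rep p q b v H\<rbrakk> \<Longrightarrow>
        uc_quad \<delta> (rep_norm p q b u G) (rep_norm p q b v H)
          (rep_norm p q b (\<lambda>x. 1 / 2 * (u x + v x)) (\<lambda>x. (1 / 2) *\<^sub>R (G x + H x)))
          (rep_norm p q b (\<lambda>x. u x - v x) (\<lambda>x. G x - H x))"
    show ?thesis
    proof (intro exI[of _ "\<delta> e"] conjI \<delta> e(1) ballI impI)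
      fix X Y :: "('a \<Rightarrow> real) set"
      assume "X \<in> E_space p q b" "Y \<in> E_space p q b"
        and *: "E_norm p q b X = 1 \<and> E_norm p q b Y = 1 \<and> E_norm p q b (ae_add X (ae_scale (- 1) Y)) \<ge> e"
      then obtain u G v H where u: "X = ae_eq `` {u}" "E_rep p q b u G"
        and v: "Y = ae_eq `` {v}" "E_rep p q b v H"
        using E_spaceE by metis
      let ?m = "rep_norm p q b (\<lambda>x. 1 / 2 * (u x + v x)) (\<lambda>x. (1 / 2) *\<^sub>R (G x + H x))"
      have norms: "rep_norm p q b u G = 1" "rep_norm p q b v H = 1"
        "e \<le> rep_norm p q b (\<lambda>x. u x - v x) (\<lambda>x. G x - H x)"
        using * by (simp_all add: u(1) v(1) E_norm_class[OF u(2)] E_norm_class[OF v(2)] E_norm_class_diff[OF u(2) v(2)])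
      have "\<forall>\<epsilon>>0. \<forall>k. rep_norm p q b u G \<le> k \<and> rep_norm p q b v H \<le> k \<and>
          \<epsilon> * k \<le> rep_norm p q b (\<lambda>x. u x - v x) (\<lambda>x. G x - H x) \<longrightarrow> ?m \<le> (1 - \<delta> \<epsilon>) * k"
        using uc[OF u(2) v(2)] unfolding uc_quad_def by blast
      from this[rule_format, OF e(1), of 1] have "?m \<le> 1 - \<delta> e" using norms by simp
      moreover have "E_norm p q b (ae_scale (1 / 2) (ae_add X Y)) = ?m"
        unfolding u(1) v(1) ae_add_class ae_scale_class
        by (rule E_norm_class[OF E_rep_scale(1)[OF E_rep_add(1)[OF u(2) v(2)]]])
      ultimately show "E_norm p q b (ae_scale (1 / 2) (ae_add X Y)) \<le> 1 - \<delta> e" by simp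
    qed
  qed
qed

end

section \<open>The ball-mass Sobolev space\<close>

theorem theorem2p6:
  fixes p q b :: real
  assumes "CARD('n::finite) \<ge> 2"
    and "1 < p"
    and "CARD('n) \<ge> 3 \<Longrightarrow> p < sobolev_exponent CARD('n)"
    and "1 \<le> q"
    and "p * q > 2"
    and "1 < b"
    and "b < b_star CARD('n) p q"
  shows "uniformly_convex_banach_space_on
    (E_space p q b :: (real ^ 'n \<Rightarrow> real) set set) ae_zero ae_add ae_scale (E_norm p q b)"
  using E_space_uniformly_convex_banach[of p q b] assms by simp

end
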